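(* Let $d\ge2$ be an integer and let $\psi=(\psi(\tau_1,\dots,\tau_d))_{(\tau_1,\dots,\tau_d)\in\Theta^d}$ be a $d$-admissible, $p$-integrable family. For $S\in\Theta$ set $$V(S)=\operatorname*{ess\,sup}_{(\tau_1,\dots,\tau_d)\in\Theta_S^d}\rho_{S,\tau_1\vee\dots\vee\tau_d}[\psi(\tau_1,\dots,\tau_d)],$$ and assume $V(S)\in L^p$ for each $S\in\Theta$. For $i\in\{1,\dots,d\}$ and $S\in\Theta$ define $$u^{(i)}(S)=\operatorname*{ess\,sup}_{(\tau_1,\dots,\tau_{i-1},\tau_{i+1},\dots,\tau_d)\in\Theta_S^{d-1}}\rho_{S,\tau_1\vee\dots\vee\tau_{i-1}\vee S\vee\tau_{i+1}\vee\dots\vee\tau_d}[\psi(\tau_1,\dots,\tau_{i-1},S,\tau_{i+1},\dots,\tau_d)],$$ $$\phi(S)=u^{(1)}(S)\vee\dots\vee u^{(d)}(S),\qquad u(S)=\operatorname*{ess\,sup}_{\tau\in\Theta_S}\rho_{S,\tau}[\phi(\tau)].$$ Let $S\in\Theta$ and assume that: i) $\theta^*\in\Theta_S$ is optimal for $u(S)$, i.e. $u(S)=\rho_{S,\theta^*}[\phi(\theta^* )]$; ii) for each $i\in\{1,\dots,d\}$, the vector $\theta^{(-i),*}=(\theta_1^{(-i),*},\dots,\theta_{i-1}^{(-i),*},\theta_{i+1}^{(-i),*},\dots,\theta_d^{(-i),*})\in\Theta_{\theta^*}^{d-1}$ is optimal for $u^{(i)}(\theta^* )$, i.e. the essential supremum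 defining $u^{(i)}(\theta^* )$ is attained at $\theta^{(-i),*}$: $$u^{(i)}(\theta^* )=\rho_{\theta^*,\,\theta^*\vee\bigvee_{j\ne i}\theta_j^{(-i),*}}[\psi(\theta_1^{(-i),*},\dots,\theta_{i-1}^{(-i),*},\theta^*,\theta_{i+1}^{(-i),*},\dots,\theta_d^{(-i),*})].$$ Let $B_1,\dots,B_d$ be a partition of $\Omega$ such that for each $i$, $B_i\in\mathcal F_{\theta^*}$ and $\phi(\theta^* )=u^{(i)}(\theta^* )$ a.s. on $B_i$. Then the vector $(\tau_1^*,\dots,\tau_d^* )$ of Bermudan stopping times defined by $$\tau_j^*=\theta^*\mathbf 1_{B_j}+\sum_{i=1,\,i\ne j}^d\theta_j^{(-i),*}\mathbf 1_{B_i},\qquad j=1,\dots,d,$$ is optimal for the non-linear $d$-stopping problem, i.e. $V(S)=\rho_{S,\tau_1^*\vee\dots\vee\tau_d^*}[\psi(\tau_1^*,\dots,\tau_d^* )]$.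
   Context: Let $T>0$ be fixed and let $(\Omega,\mathcal F,P)$ be a complete probability space with a right-continuous complete filtration $(\mathcal F_t)_{t\in[0,T]}$. Equalities and inequalities between random variables, and equalities between measurable sets, are understood $P$-a.s. Let $(\theta_k)_{k\in\mathbb N}$ be a sequence of stopping times with $\theta_0=0$, $\theta_k\le\theta_{k+1}$ a.s. for all $k$, and $\lim_k\theta_k=T$ a.s. $\Theta$ (Bermudan stopping strategies) is the set of stopping times of the form $\tau=\sum_{k\ge0}\theta_k\mathbf 1_{A_k}+T\mathbf 1_{\bar A}$, where $\{(A_k)_{k\ge 0},\bar A\}$ is a partition of $\Omega$ with $A_k\in\mathcal F_{\theta_k}$ and $\bar A\in\mathcal F_T$. For $S\in\Theta$, $\Theta_S=\{\nu\in\Theta:\nu\ge S\text{ a.s.}\}$. Fix $p\in[1,+\infty]$. (In the claim, $\theta^*$ and $\theta_j^{(-i),*}$ are elements of $\Theta$ unrelated to the sequence $(\theta_k)$.) A family $\xi=(\xi(\tau))_{\tau\in\Theta}$ of real random variables is admissible if $\xi(\tau)$ is $\mathcal F_\tau$-measurable and $\xi(\tau)=\xi(\tau')$ a.s. on $\{\tau=\tau'\}$ for all $\tau,\tau'\in\Theta$; it is $p$-integrable if each $\xi(\tau)\in L^p$. A family $(\psi(\tau_1,\dots,\tau_d))_{(\tau_1,\dots,\tau_d)\in\Theta^d}$ is $d$-admissible if $\psi(\tau_1,\dots,\tau_d)$ is $\mathcal F_{\tau_1\vee\dots\vee\tau_d}$-measurable and $\psi(\tau_1,\dots,\tau_d)=\psi(\tilde\tau_1,\dots,\tilde\tau_d)$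 on $\bigcap_i\{\tau_i=\tilde\tau_i\}$; it is $p$-integrable if each $\psi(\tau_1,\dots,\tau_d)\in L^p$. Bi-admissible means $2$-admissible. The operators $\rho_{S,\tau}$, $S,\tau\in\Theta$, satisfy: (i) $\rho_{S,\tau}:L^p(\mathcal F_\tau)\to L^p(\mathcal F_S)$. (ii) (admissibility) $\rho_{S,\tau}[\eta]=\rho_{S',\tau}[\eta]$ a.s. on $\{S=S'\}$. (iii) (knowledge preservation) $\rho_{\tau,S}[\eta]=\eta$ for all $\eta\in L^p(\mathcal F_S)$, $\tau\in\Theta_S$. (iv) (monotonicity) $\rho_{S,\tau}[\eta_1]\le\rho_{S,\tau}[\eta_2]$ if $\eta_1\le\eta_2$ a.s. (v) (consistency) $\rho_{S,\theta}[\rho_{\theta,\tau}[\eta]]=\rho_{S,\tau}[\eta]$ for $S\le\theta\le\tau$ in $\Theta$, $\eta\in L^p(\mathcal F_\tau)$. (vi) (generalized zero-one law) $\mathbf 1_A\rho_{S,\tau}[\xi(\tau)]=\mathbf 1_A\rho_{S,\tau'}[\xi(\tau')]$ for every admissible $p$-integrable family $\xi$, $A\in\mathcal F_S$, $\tau,\tau'\in\Theta_S$ with $\tau=\tau'$ on $A$. (vi bis) For every bi-admissible $p$-integrable family $\chi$ and all Bermudan stopping times: $\mathbf 1_{\{\tau_1=\tau_1'\}}\rho_{\tau_1,\tau_1\vee\tau_2}[\chi(\tau_1,\tau_2)]=\mathbf 1_{\{\tau_1=\tau_1'\}}\rho_{\tau_1',\tau_1'\vee\tau_2}[\chi(\tau_1',\tau_2)]$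 and $\mathbf 1_{\{\tau_2=\tau_2'\}}\rho_{\tau_2,\tau_1\vee\tau_2}[\chi(\tau_1,\tau_2)]=\mathbf 1_{\{\tau_2=\tau_2'\}}\rho_{\tau_2',\tau_1\vee\tau_2'}[\chi(\tau_1,\tau_2')]$. (vi ter) For every bi-admissible $p$-integrable family $\chi$, all $\tau_1,\tau_2\in\Theta$ and $A\in\mathcal F_{\tau_1\wedge\tau_2}$ such that $\tau_1\wedge\tau_2=\tau_1$ and $\tau_1\vee\tau_2=\tau_2$ a.s. on $A$: $\mathbf 1_A\rho_{\tau_1\wedge\tau_2,\tau_1\vee\tau_2}[\chi(\tau_1\wedge\tau_2,\tau_1\vee\tau_2)]=\mathbf 1_A\rho_{\tau_1\wedge\tau_2,\tau_1\vee\tau_2}[\chi(\tau_1,\tau_2)]=\mathbf 1_A\rho_{\tau_1,\tau_1\vee\tau_2}[\chi(\tau_1,\tau_2)]$, and $\mathbf 1_A\rho_{\tau_1\wedge\tau_2,\tau_1\vee\tau_2}[\chi(\tau_1\vee\tau_2,\tau_1\wedge\tau_2)]=\mathbf 1_A\rho_{\tau_1\wedge\tau_2,\tau_1\vee\tau_2}[\chi(\tau_2,\tau_1)]=\mathbf 1_A\rho_{\tau_1,\tau_1\vee\tau_2}[\chi(\tau_2,\tau_1)]$. (vii) (monotone Fatou property) $\rho_{S,\tau}[\eta]\le\liminf_n\rho_{S,\tau}[\eta_n]$ whenever $(\eta_n)\subset L^p(\mathcal F_\tau)$ is non-decreasing, $\sup_n\eta_n\in L^p$ and $\eta_n\uparrow\eta$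 a.s. ($d$-property) For every $d$-admissible $p$-integrable family $\chi$, all $(\tau_1,\dots,\tau_d),(\tau_1',\dots,\tau_d')\in\Theta^d$ and $A\in\mathcal F_{\tau_1\wedge\dots\wedge\tau_d}$ with $\tau_i=\tau_i'$ on $A$ for all $i$: $\mathbf 1_A\rho_{\tau_1\wedge\dots\wedge\tau_d,\tau_1\vee\dots\vee\tau_d}[\chi(\tau_1,\dots,\tau_d)]=\mathbf 1_A\rho_{\tau_1'\wedge\dots\wedge\tau_d',\tau_1'\vee\dots\vee\tau_d'}[\chi(\tau_1',\dots,\tau_d')]$. *)

theory Defs
  imports "HOL-Probability.Probability"
begin

unbundle lattice_syntax

section \<open>Essential suprema and \<open>L\<^sup>p\<close>\<close>

text \<open>
  Random variables are represented by functions, not by classes modulo null sets.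
  The essential supremum of a family is determined only up to a null set, and it may a priori be
  infinite, so it is an extended-real function and \<open>ess_sup\<close> picks an arbitrary version.
  (The constant \<^const>\<open>esssup\<close> of the library is the essential supremum of a single function.)
\<close>

definition is_ess_sup :: "'a measure \<Rightarrow> 'i set \<Rightarrow> ('i \<Rightarrow> 'a \<Rightarrow> real) \<Rightarrow> ('a \<Rightarrow> ereal) \<Rightarrow> bool" where
  "is_ess_sup M I X Z \<longleftrightarrow>
     Z \<in> borel_measurable M \<and>
     (\<forall>i\<in>I. AE \<omega> in M. ereal (X i \<omega>) \<le> Z \<omega>) \<and>
     (\<forall>Y\<in>borel_measurable M.
        (\<forall>i\<in>I. AE \<omega> in M. ereal (X i \<omega>) \<le> Y \<omega>) \<longrightarrow> (AE \<omega> in M. Z \<omega> \<le> Y \<omega>))"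

definition ess_sup :: "'a measure \<Rightarrow> 'i set \<Rightarrow> ('i \<Rightarrow> 'a \<Rightarrow> real) \<Rightarrow> 'a \<Rightarrow> ereal" where
  "ess_sup M I X = (SOME Z. is_ess_sup M I X Z)"

definition Lp :: "'a measure \<Rightarrow> ennreal \<Rightarrow> ('a \<Rightarrow> real) set" where
  "Lp M p = {f \<in> borel_measurable M.
     if p = \<infinity> then esssup M (\<lambda>\<omega>. ereal \<bar>f \<omega>\<bar>) < \<infinity>
     else integrable M (\<lambda>\<omega>. \<bar>f \<omega>\<bar> powr enn2real p)}"

text \<open>
  The almost sure finiteness is essential here, because \<^const>\<open>real_of_ereal\<close> maps the
  infinite values to \<open>0\<close>.
\<close>

definition ereal_in_Lp :: "'a measure \<Rightarrow> ennreal \<Rightarrow> ('a \<Rightarrow> ereal) \<Rightarrow> bool" where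
  "ereal_in_Lp M p Z \<longleftrightarrow>
     (AE \<omega> in M. \<bar>Z \<omega>\<bar> \<noteq> \<infinity>) \<and> (\<lambda>\<omega>. real_of_ereal (Z \<omega>)) \<in> Lp M p"

definition vsup :: "nat \<Rightarrow> (nat \<Rightarrow> 'a \<Rightarrow> real) \<Rightarrow> 'a \<Rightarrow> real" where
  "vsup d \<tau> = (\<lambda>\<omega>. MAX i\<in>{1..d}. \<tau> i \<omega>)"

definition vinf :: "nat \<Rightarrow> (nat \<Rightarrow> 'a \<Rightarrow> real) \<Rightarrow> 'a \<Rightarrow> real" where
  "vinf d \<tau> = (\<lambda>\<omega>. MIN i\<in>{1..d}. \<tau> i \<omega>)"


section \<open>Bermudan stopping strategies\<close>

text \<open>
  The filtration is indexed by the reals so that the library notions of filtration and stopping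
  time apply, but only its part over \<open>[0,T]\<close> matters: a filtration over \<open>[0,T]\<close> extends
  constantly to both sides, and for a \<open>[0,T]\<close>-valued \<open>\<tau>\<close> neither being a stopping time nor the
  \<open>\<sigma>\<close>-algebra \<open>pre_sigma \<tau>\<close>, i.e. \<open>\<F>\<^sub>\<tau>\<close>, depends on \<open>F t\<close> for \<open>t \<notin> [0,T]\<close>. Only the
  \<open>\<sigma>\<close>-algebras \<open>F t\<close> and \<open>pre_sigma \<tau>\<close> are used; all null sets are those of \<open>M\<close>.
\<close>

locale bermudan_setting =
  prob_space M + complete_measure M + filtration "space M" F
  for M :: "'a measure" and F :: "real \<Rightarrow> 'a measure" +
  fixes T :: real
    and \<theta> :: "nat \<Rightarrow> 'a \<Rightarrow> real"
  assumes T_pos: "0 < T"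
    and F_subset: "\<And>t. 0 \<le> t \<Longrightarrow> t \<le> T \<Longrightarrow> sets (F t) \<subseteq> sets M"
    and F_complete: "null_sets M \<subseteq> sets (F 0)"
    and F_right_continuous: "\<And>t. 0 \<le> t \<Longrightarrow> t < T \<Longrightarrow> sets (F t) = (\<Inter>s\<in>{t<..T}. sets (F s))"
    and theta_stopping_time: "\<And>k. stopping_time F (\<theta> k)"
    and theta_range: "\<And>k. \<theta> k \<in> space M \<rightarrow> {0..T}"
    and theta_zero: "AE \<omega> in M. \<theta> 0 \<omega> = 0"
    and theta_mono: "\<And>k. AE \<omega> in M. \<theta> k \<omega> \<le> \<theta> (Suc k) \<omega>"
    and theta_lim: "AE \<omega> in M. (\<lambda>k. \<theta> k \<omega>) \<longlonglongrightarrow> T"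
begin

text \<open>
  The sets \<open>A k\<close> together with \<open>A'\<close> partition the sample space up to a null set, so that \<open>Theta\<close>
  is closed under almost sure equality.
\<close>

definition Theta :: "('a \<Rightarrow> real) set" where
  "Theta = {\<tau>. stopping_time F \<tau> \<and> \<tau> \<in> space M \<rightarrow> {0..T} \<and>
     (\<exists>A A'. (\<forall>k. A k \<in> sets (pre_sigma (\<theta> k))) \<and> A' \<in> sets (F T) \<and>
        (AE \<omega> in M. (\<omega> \<notin> A' \<and> (\<exists>!k. \<omega> \<in> A k)) \<or> (\<omega> \<in> A' \<and> (\<forall>k. \<omega> \<notin> A k))) \<and>
        (AE \<omega> in M. \<tau> \<omega> = (\<Sum>k. \<theta> k \<omega> * indicator (A k) \<omega>) + T * indicator A' \<omega>))}"

definition Theta_from :: "('a \<Rightarrow> real) \<Rightarrow> ('a \<Rightarrow> real) set" where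
  "Theta_from S = {\<tau> \<in> Theta. AE \<omega> in M. S \<omega> \<le> \<tau> \<omega>}"

definition Lp_at :: "ennreal \<Rightarrow> ('a \<Rightarrow> real) \<Rightarrow> ('a \<Rightarrow> real) set" where
  "Lp_at p \<tau> = Lp M p \<inter> borel_measurable (pre_sigma \<tau>)"

definition admissible :: "(('a \<Rightarrow> real) \<Rightarrow> 'a \<Rightarrow> real) \<Rightarrow> bool" where
  "admissible \<xi> \<longleftrightarrow>
     (\<forall>\<tau>\<in>Theta. \<xi> \<tau> \<in> borel_measurable (pre_sigma \<tau>)) \<and>
     (\<forall>\<tau>\<in>Theta. \<forall>\<tau>'\<in>Theta. AE \<omega> in M. \<tau> \<omega> = \<tau>' \<omega> \<longrightarrow> \<xi> \<tau> \<omega> = \<xi> \<tau>' \<omega>)"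

definition p_integrable :: "ennreal \<Rightarrow> (('a \<Rightarrow> real) \<Rightarrow> 'a \<Rightarrow> real) \<Rightarrow> bool" where
  "p_integrable p \<xi> \<longleftrightarrow> (\<forall>\<tau>\<in>Theta. \<xi> \<tau> \<in> Lp M p)"

definition d_admissible :: "nat \<Rightarrow> ((nat \<Rightarrow> 'a \<Rightarrow> real) \<Rightarrow> 'a \<Rightarrow> real) \<Rightarrow> bool" where
  "d_admissible d \<psi> \<longleftrightarrow>
     (\<forall>\<tau>\<in>{1..d} \<rightarrow>\<^sub>E Theta. \<psi> \<tau> \<in> borel_measurable (pre_sigma (vsup d \<tau>))) \<and>
     (\<forall>\<tau>\<in>{1..d} \<rightarrow>\<^sub>E Theta. \<forall>\<tau>'\<in>{1..d} \<rightarrow>\<^sub>E Theta.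
        AE \<omega> in M. (\<forall>i\<in>{1..d}. \<tau> i \<omega> = \<tau>' i \<omega>) \<longrightarrow> \<psi> \<tau> \<omega> = \<psi> \<tau>' \<omega>)"

definition d_p_integrable :: "ennreal \<Rightarrow> nat \<Rightarrow> ((nat \<Rightarrow> 'a \<Rightarrow> real) \<Rightarrow> 'a \<Rightarrow> real) \<Rightarrow> bool" where
  "d_p_integrable p d \<psi> \<longleftrightarrow> (\<forall>\<tau>\<in>{1..d} \<rightarrow>\<^sub>E Theta. \<psi> \<tau> \<in> Lp M p)"

definition bi_family :: "ennreal \<Rightarrow> (('a \<Rightarrow> real) \<Rightarrow> ('a \<Rightarrow> real) \<Rightarrow> 'a \<Rightarrow> real) \<Rightarrow> bool" where
  "bi_family p \<zeta> \<longleftrightarrow>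
     d_admissible 2 (\<lambda>\<tau>. \<zeta> (\<tau> 1) (\<tau> 2)) \<and> d_p_integrable p 2 (\<lambda>\<tau>. \<zeta> (\<tau> 1) (\<tau> 2))"

end


section \<open>Non-linear operators and value functions\<close>

text \<open>
  An identity \<open>\<one>\<^sub>A X = \<one>\<^sub>A Y\<close> is written \<open>AE \<omega> in M. \<omega> \<in> A \<longrightarrow> X \<omega> = Y \<omega>\<close>. That each
  \<open>\<rho> S \<tau>\<close> respects almost sure equality is not a separate assumption: it is a consequence of
  monotonicity.
\<close>

locale nonlinear_stopping = bermudan_setting M F T \<theta>
  for M :: "'a measure" and F :: "real \<Rightarrow> 'a measure" and T :: real and \<theta> :: "nat \<Rightarrow> 'a \<Rightarrow> real" +
  fixes p :: ennreal
    and d :: nat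
    and \<rho> :: "('a \<Rightarrow> real) \<Rightarrow> ('a \<Rightarrow> real) \<Rightarrow> ('a \<Rightarrow> real) \<Rightarrow> 'a \<Rightarrow> real"
  assumes p_ge_1: "1 \<le> p"
    and d_ge_2: "2 \<le> d"
    and rho_Lp: "\<And>S \<tau> \<eta>. \<lbrakk>S \<in> Theta; \<tau> \<in> Theta; \<eta> \<in> Lp_at p \<tau>\<rbrakk> \<Longrightarrow> \<rho> S \<tau> \<eta> \<in> Lp_at p S"
    and rho_admissible:
      "\<And>S S' \<tau> \<eta>. \<lbrakk>S \<in> Theta; S' \<in> Theta; \<tau> \<in> Theta; \<eta> \<in> Lp_at p \<tau>\<rbrakk> \<Longrightarrow>
         AE \<omega> in M. S \<omega> = S' \<omega> \<longrightarrow> \<rho> S \<tau> \<eta> \<omega> = \<rho> S' \<tau> \<eta> \<omega>"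
    and knowledge_preservation:
      "\<And>S \<tau> \<eta>. \<lbrakk>S \<in> Theta; \<tau> \<in> Theta_from S; \<eta> \<in> Lp_at p S\<rbrakk> \<Longrightarrow>
         AE \<omega> in M. \<rho> \<tau> S \<eta> \<omega> = \<eta> \<omega>"
    and monotonicity:
      "\<And>S \<tau> \<eta>1 \<eta>2. \<lbrakk>S \<in> Theta; \<tau> \<in> Theta; \<eta>1 \<in> Lp_at p \<tau>; \<eta>2 \<in> Lp_at p \<tau>;
          AE \<omega> in M. \<eta>1 \<omega> \<le> \<eta>2 \<omega>\<rbrakk> \<Longrightarrow> AE \<omega> in M. \<rho> S \<tau> \<eta>1 \<omega> \<le> \<rho> S \<tau> \<eta>2 \<omega>"
    and consistency:
      "\<And>S \<sigma> \<tau> \<eta>. \<lbrakk>S \<in> Theta; \<sigma> \<in> Theta; \<tau> \<in> Theta;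
          AE \<omega> in M. S \<omega> \<le> \<sigma> \<omega>; AE \<omega> in M. \<sigma> \<omega> \<le> \<tau> \<omega>; \<eta> \<in> Lp_at p \<tau>\<rbrakk> \<Longrightarrow>
         AE \<omega> in M. \<rho> S \<sigma> (\<rho> \<sigma> \<tau> \<eta>) \<omega> = \<rho> S \<tau> \<eta> \<omega>"
    and zero_one_law:
      "\<And>\<xi> S \<tau> \<tau>' A. \<lbrakk>admissible \<xi>; p_integrable p \<xi>; S \<in> Theta; A \<in> sets (pre_sigma S);
          \<tau> \<in> Theta_from S; \<tau>' \<in> Theta_from S; AE \<omega> in M. \<omega> \<in> A \<longrightarrow> \<tau> \<omega> = \<tau>' \<omega>\<rbrakk> \<Longrightarrow>
         AE \<omega> in M. \<omega> \<in> A \<longrightarrow> \<rho> S \<tau> (\<xi> \<tau>) \<omega> = \<rho> S \<tau>' (\<xi> \<tau>') \<omega>"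
    and zero_one_law_bis_1:
      "\<And>\<zeta> \<tau>1 \<tau>1' \<tau>2. \<lbrakk>bi_family p \<zeta>; \<tau>1 \<in> Theta; \<tau>1' \<in> Theta; \<tau>2 \<in> Theta\<rbrakk> \<Longrightarrow>
         AE \<omega> in M. \<tau>1 \<omega> = \<tau>1' \<omega> \<longrightarrow>
           \<rho> \<tau>1 (\<tau>1 \<squnion> \<tau>2) (\<zeta> \<tau>1 \<tau>2) \<omega> = \<rho> \<tau>1' (\<tau>1' \<squnion> \<tau>2) (\<zeta> \<tau>1' \<tau>2) \<omega>"
    and zero_one_law_bis_2:
      "\<And>\<zeta> \<tau>1 \<tau>2 \<tau>2'. \<lbrakk>bi_family p \<zeta>; \<tau>1 \<in> Theta; \<tau>2 \<in> Theta; \<tau>2' \<in> Theta\<rbrakk> \<Longrightarrow>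
         AE \<omega> in M. \<tau>2 \<omega> = \<tau>2' \<omega> \<longrightarrow>
           \<rho> \<tau>2 (\<tau>1 \<squnion> \<tau>2) (\<zeta> \<tau>1 \<tau>2) \<omega> = \<rho> \<tau>2' (\<tau>1 \<squnion> \<tau>2') (\<zeta> \<tau>1 \<tau>2') \<omega>"
    and zero_one_law_ter_1:
      "\<And>\<zeta> \<tau>1 \<tau>2 A. \<lbrakk>bi_family p \<zeta>; \<tau>1 \<in> Theta; \<tau>2 \<in> Theta; A \<in> sets (pre_sigma (\<tau>1 \<sqinter> \<tau>2));
          AE \<omega> in M. \<omega> \<in> A \<longrightarrow> (\<tau>1 \<sqinter> \<tau>2) \<omega> = \<tau>1 \<omega> \<and> (\<tau>1 \<squnion> \<tau>2) \<omega> = \<tau>2 \<omega>\<rbrakk> \<Longrightarrow>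
         AE \<omega> in M. \<omega> \<in> A \<longrightarrow>
           \<rho> (\<tau>1 \<sqinter> \<tau>2) (\<tau>1 \<squnion> \<tau>2) (\<zeta> (\<tau>1 \<sqinter> \<tau>2) (\<tau>1 \<squnion> \<tau>2)) \<omega>
             = \<rho> (\<tau>1 \<sqinter> \<tau>2) (\<tau>1 \<squnion> \<tau>2) (\<zeta> \<tau>1 \<tau>2) \<omega> \<and>
           \<rho> (\<tau>1 \<sqinter> \<tau>2) (\<tau>1 \<squnion> \<tau>2) (\<zeta> \<tau>1 \<tau>2) \<omega> = \<rho> \<tau>1 (\<tau>1 \<squnion> \<tau>2) (\<zeta> \<tau>1 \<tau>2) \<omega>"
    and zero_one_law_ter_2:
      "\<And>\<zeta> \<tau>1 \<tau>2 A. \<lbrakk>bi_family p \<zeta>; \<tau>1 \<in> Theta; \<tau>2 \<in> Theta; A \<in> sets (pre_sigma (\<tau>1 \<sqinter> \<tau>2));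
          AE \<omega> in M. \<omega> \<in> A \<longrightarrow> (\<tau>1 \<sqinter> \<tau>2) \<omega> = \<tau>1 \<omega> \<and> (\<tau>1 \<squnion> \<tau>2) \<omega> = \<tau>2 \<omega>\<rbrakk> \<Longrightarrow>
         AE \<omega> in M. \<omega> \<in> A \<longrightarrow>
           \<rho> (\<tau>1 \<sqinter> \<tau>2) (\<tau>1 \<squnion> \<tau>2) (\<zeta> (\<tau>1 \<squnion> \<tau>2) (\<tau>1 \<sqinter> \<tau>2)) \<omega>
             = \<rho> (\<tau>1 \<sqinter> \<tau>2) (\<tau>1 \<squnion> \<tau>2) (\<zeta> \<tau>2 \<tau>1) \<omega> \<and>
           \<rho> (\<tau>1 \<sqinter> \<tau>2) (\<tau>1 \<squnion> \<tau>2) (\<zeta> \<tau>2 \<tau>1) \<omega> = \<rho> \<tau>1 (\<tau>1 \<squnion> \<tau>2) (\<zeta> \<tau>2 \<tau>1) \<omega>"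
    and monotone_Fatou:
      "\<And>S \<tau> \<eta> \<eta>s. \<lbrakk>S \<in> Theta; \<tau> \<in> Theta; \<And>n. \<eta>s n \<in> Lp_at p \<tau>; \<eta> \<in> Lp_at p \<tau>;
          \<And>n. AE \<omega> in M. \<eta>s n \<omega> \<le> \<eta>s (Suc n) \<omega>; AE \<omega> in M. (\<lambda>n. \<eta>s n \<omega>) \<longlonglongrightarrow> \<eta> \<omega>\<rbrakk> \<Longrightarrow>
         AE \<omega> in M. ereal (\<rho> S \<tau> \<eta> \<omega>) \<le> liminf (\<lambda>n. ereal (\<rho> S \<tau> (\<eta>s n) \<omega>))"
    and d_property:
      "\<And>\<zeta> \<tau> \<tau>' A. \<lbrakk>d_admissible d \<zeta>; d_p_integrable p d \<zeta>;
          \<tau> \<in> {1..d} \<rightarrow>\<^sub>E Theta; \<tau>' \<in> {1..d} \<rightarrow>\<^sub>E Theta; A \<in> sets (pre_sigma (vinf d \<tau>));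
          \<And>i. i \<in> {1..d} \<Longrightarrow> AE \<omega> in M. \<omega> \<in> A \<longrightarrow> \<tau> i \<omega> = \<tau>' i \<omega>\<rbrakk> \<Longrightarrow>
         AE \<omega> in M. \<omega> \<in> A \<longrightarrow>
           \<rho> (vinf d \<tau>) (vsup d \<tau>) (\<zeta> \<tau>) \<omega> = \<rho> (vinf d \<tau>') (vsup d \<tau>') (\<zeta> \<tau>') \<omega>"
begin

definition reward :: "((nat \<Rightarrow> 'a \<Rightarrow> real) \<Rightarrow> 'a \<Rightarrow> real) \<Rightarrow> ('a \<Rightarrow> real) \<Rightarrow> (nat \<Rightarrow> 'a \<Rightarrow> real) \<Rightarrow> 'a \<Rightarrow> real"
  where "reward \<psi> S \<tau> = \<rho> S (vsup d \<tau>) (\<psi> \<tau>)"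

definition V :: "((nat \<Rightarrow> 'a \<Rightarrow> real) \<Rightarrow> 'a \<Rightarrow> real) \<Rightarrow> ('a \<Rightarrow> real) \<Rightarrow> 'a \<Rightarrow> ereal" where
  "V \<psi> S = ess_sup M ({1..d} \<rightarrow>\<^sub>E Theta_from S) (\<lambda>\<tau>. reward \<psi> S \<tau>)"

definition u_coord :: "((nat \<Rightarrow> 'a \<Rightarrow> real) \<Rightarrow> 'a \<Rightarrow> real) \<Rightarrow> nat \<Rightarrow> ('a \<Rightarrow> real) \<Rightarrow> 'a \<Rightarrow> ereal" where
  "u_coord \<psi> i S =
     ess_sup M (({1..d} - {i}) \<rightarrow>\<^sub>E Theta_from S) (\<lambda>\<tau>. reward \<psi> S (\<tau>(i := S)))"

definition phi :: "((nat \<Rightarrow> 'a \<Rightarrow> real) \<Rightarrow> 'a \<Rightarrow> real) \<Rightarrow> ('a \<Rightarrow> real) \<Rightarrow> 'a \<Rightarrow> ereal" where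
  "phi \<psi> S = (\<lambda>\<omega>. MAX i\<in>{1..d}. u_coord \<psi> i S \<omega>)"

text \<open>
  \<open>\<rho>\<close> acts on real functions. If all \<open>V \<psi> S\<close> are in \<open>L\<^sup>p\<close>, then \<open>phi \<psi> \<tau>\<close> is almost surely finite
  and \<open>phi_real\<close> is a version of it.
\<close>

definition phi_real :: "((nat \<Rightarrow> 'a \<Rightarrow> real) \<Rightarrow> 'a \<Rightarrow> real) \<Rightarrow> ('a \<Rightarrow> real) \<Rightarrow> 'a \<Rightarrow> real" where
  "phi_real \<psi> \<tau> = (\<lambda>\<omega>. real_of_ereal (phi \<psi> \<tau> \<omega>))"

definition u :: "((nat \<Rightarrow> 'a \<Rightarrow> real) \<Rightarrow> 'a \<Rightarrow> real) \<Rightarrow> ('a \<Rightarrow> real) \<Rightarrow> 'a \<Rightarrow> ereal" where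
  "u \<psi> S = ess_sup M (Theta_from S) (\<lambda>\<tau>. \<rho> S \<tau> (phi_real \<psi> \<tau>))"

end

end

theory Submission
  imports Defs
begin

text \<open>
  The \<open>d\<close>-fold problem reduces to a single stopping problem, because at the moment when the first
  of the \<open>d\<close> components stops, what remains is a problem for the other components, and \<open>\<phi>\<close> is the
  best value of such a remainder.

  For \<open>V(S) \<le> u(S)\<close>, take a vector \<open>\<tau>\<close> of strategies after \<open>S\<close> and let \<open>m\<close> be its minimum. The
  events \<open>{\<tau>\<^sub>i = m}\<close> cover \<open>\<Omega>\<close>, and on each of them the \<open>d\<close>-property allows \<open>\<tau>\<^sub>i\<close> to be
  replaced by \<open>m\<close> without changing the value seen from \<open>m\<close>. After the replacement the vector competes
  in the definition of \<open>u\<^sup>(\<^sup>i\<^sup>)(m)\<close>, so the value of \<open>\<tau>\<close> seen from \<open>m\<close> is at most \<open>\<phi>(m)\<close>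
  (\<open>reward_at_vinf_le_phi\<close>). Consistency and monotonicity carry this inequality from \<open>m\<close> back to \<open>S\<close>
  (\<open>reward_le_u\<close>).

  Conversely, the vector \<open>\<tau>\<^sup>*\<close> coincides on \<open>B\<^sub>i\<close> with the vector that is optimal for
  \<open>u\<^sup>(\<^sup>i\<^sup>)(\<theta>\<^sup>*)\<close>, and both vectors have minimum \<open>\<theta>\<^sup>*\<close> almost surely. By the \<open>d\<close>-property its value seen from
  \<open>\<theta>\<^sup>*\<close> is \<open>u\<^sup>(\<^sup>i\<^sup>)(\<theta>\<^sup>*) = \<phi>(\<theta>\<^sup>*)\<close> on \<open>B\<^sub>i\<close>, hence \<open>\<phi>(\<theta>\<^sup>*)\<close> almost surely. Consistency and
  the optimality of \<open>\<theta>\<^sup>*\<close> turn this into: the value of \<open>\<tau>\<^sup>*\<close> seen from \<open>S\<close> is \<open>u(S)\<close>. Since this value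
  is at most \<open>V(S) \<le> u(S)\<close>, all three agree (\<open>pasted_strategy_optimal\<close>).

  Three facts make these steps legitimate. Essential suprema exist and are countable suprema, so that
  \<open>\<phi>(S)\<close> is \<open>\<F>\<^sub>S\<close>-measurable (\<open>countable_essential_supremum\<close>, \<open>u_coord_measurable\<close>). The random
  variable \<open>\<phi>(S)\<close> lies in \<open>L\<^sup>p\<close>, because it is squeezed between one reward and \<open>V(S)\<close>
  (\<open>phi_real_Lp_at\<close>). Bermudan strategies are closed under finite maxima, finite minima and pasting,
  which becomes transparent once they are recognised as the stopping times with values among the
  \<open>\<theta>\<^sub>k\<close> and \<open>T\<close> (\<open>Theta_iff\<close>).
\<close>

section \<open>Essential suprema and \<open>L\<^sup>p\<close>\<close>

text \<open>
  A countable subfamily is chosen that maximises, among all countable subfamilies, the integral of a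
  bounded strictly increasing transform of the supremum. Adjoining one more member cannot increase
  that integral, hence almost surely it does not increase the supremum. The countable form is what
  yields measurability of the essential supremum with respect to smaller \<open>\<sigma>\<close>-algebras.
\<close>

lemma countable_essential_supremum:
  fixes X :: "'i \<Rightarrow> 'a \<Rightarrow> real"
  assumes "finite_measure M" and X: "\<And>i. i \<in> I \<Longrightarrow> X i \<in> borel_measurable M"
  obtains C where "countable C" "C \<subseteq> I" "is_ess_sup M I X (\<lambda>\<omega>. \<Squnion>i\<in>C. ereal (X i \<omega>))"
proof -
  interpret finite_measure M by fact
  \<comment> \<open>A strictly increasing map into a bounded interval makes all integrals finite.\<close>
  define h :: "real \<Rightarrow> ennreal" where "h x = ennreal (arctan x + pi / 2)" for x
  have h_less: "h x < h y" if "x < y" for x y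
    unfolding h_def using that arctan_lbound[of x] arctan_monotone[of x y]
    by (intro ennreal_lessI) auto
  have h_bound: "h x \<le> ennreal pi" for x
    unfolding h_def using arctan_ubound[of x] by (intro ennreal_leI) auto
  have [measurable]: "h \<in> borel_measurable borel"
    unfolding h_def by measurable
  define G where "G C \<omega> = (\<Squnion>i\<in>C. h (X i \<omega>))" for C \<omega>
  have G_meas: "G C \<in> borel_measurable M" if "countable C" "C \<subseteq> I" for C
    unfolding G_def using that X
    by (intro borel_measurable_SUP) (auto intro!: measurable_compose[OF X])
  define \<C> where "\<C> = {C. countable C \<and> C \<subseteq> I}"
  have "\<C> \<noteq> {}" by (auto simp: \<C>_def)
  then obtain f :: "nat \<Rightarrow> ennreal"
    where f: "range f \<subseteq> (\<lambda>C. \<integral>\<^sup>+\<omega>. G C \<omega> \<partial>M) ` \<C>"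
      "(\<Squnion>C\<in>\<C>. \<integral>\<^sup>+\<omega>. G C \<omega> \<partial>M) = (\<Squnion>n. f n)"
    using ennreal_SUP_countable_SUP[of \<C> "\<lambda>C. \<integral>\<^sup>+\<omega>. G C \<omega> \<partial>M"] by auto
  have "\<exists>C\<in>\<C>. f n = (\<integral>\<^sup>+\<omega>. G C \<omega> \<partial>M)" for n
    using f(1) by blast
  then obtain D where D: "\<And>n. D n \<in> \<C>" "\<And>n. f n = (\<integral>\<^sup>+\<omega>. G (D n) \<omega> \<partial>M)"
    by metis
  \<comment> \<open>The union of a maximising sequence of countable subfamilies attains the maximum.\<close>
  define C where "C = (\<Union>n. D n)"
  have C: "countable C" "C \<subseteq> I"
    using D(1) by (auto simp: C_def \<C>_def)
  have G_mono: "G A \<omega> \<le> G B \<omega>" if "A \<subseteq> B" for A B \<omega>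
    unfolding G_def using that by (intro SUP_subset_mono) auto
  have sup_le: "(\<integral>\<^sup>+\<omega>. G A \<omega> \<partial>M) \<le> (\<integral>\<^sup>+\<omega>. G C \<omega> \<partial>M)" if "A \<in> \<C>" for A
  proof -
    have "(\<integral>\<^sup>+\<omega>. G A \<omega> \<partial>M) \<le> (\<Squnion>n. f n)"
      unfolding f(2)[symmetric] using that by (intro SUP_upper)
    also have "\<dots> \<le> (\<integral>\<^sup>+\<omega>. G C \<omega> \<partial>M)"
      unfolding D(2) by (intro SUP_least nn_integral_mono G_mono) (auto simp: C_def)
    finally show ?thesis .
  qed
  have dominates: "AE \<omega> in M. ereal (X i \<omega>) \<le> (\<Squnion>i\<in>C. ereal (X i \<omega>))" if i: "i \<in> I" for i
  proof -
    have iC: "countable (insert i C)" "insert i C \<subseteq> I" using C i by auto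
    have fin: "(\<integral>\<^sup>+\<omega>. G C \<omega> \<partial>M) \<noteq> \<infinity>"
    proof -
      have "(\<integral>\<^sup>+\<omega>. G C \<omega> \<partial>M) \<le> (\<integral>\<^sup>+\<omega>. ennreal pi \<partial>M)"
        unfolding G_def by (intro nn_integral_mono SUP_least h_bound)
      also have "\<dots> < \<infinity>" by (simp add: ennreal_mult_less_top emeasure_eq_measure)
      finally show ?thesis by simp
    qed
    have "AE \<omega> in M. G (insert i C) \<omega> \<le> G C \<omega>"
    proof (rule ccontr)
      assume "\<not> (AE \<omega> in M. G (insert i C) \<omega> \<le> G C \<omega>)"
      then have "(\<integral>\<^sup>+\<omega>. G C \<omega> \<partial>M) < (\<integral>\<^sup>+\<omega>. G (insert i C) \<omega> \<partial>M)"
        using fin by (intro nn_integral_less G_meas C iC AE_I2 G_mono subset_insertI)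
      then show False
        using sup_le[of "insert i C"] iC unfolding \<C>_def by (metis leD mem_Collect_eq)
    qed
    then show ?thesis
    proof (rule AE_mp, intro AE_I2 impI)
      fix \<omega> assume le: "G (insert i C) \<omega> \<le> G C \<omega>"
      show "ereal (X i \<omega>) \<le> (\<Squnion>i\<in>C. ereal (X i \<omega>))"
      proof (rule ccontr)
        assume "\<not> ?thesis"
        \<comment> \<open>A level \<open>r\<close> strictly between the two values separates their images under \<open>h\<close>.\<close>
        then obtain r where r: "(\<Squnion>i\<in>C. ereal (X i \<omega>)) < ereal r" "ereal r < ereal (X i \<omega>)"
          using ereal_dense2 by (metis not_le)
        have "X j \<omega> < r" if "j \<in> C" for j
          using r(1) that by (metis SUP_lessD less_ereal.simps(1))
        then have "G C \<omega> \<le> h r"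
          unfolding G_def by (intro SUP_least) (auto intro!: less_imp_le h_less)
        also have "h r < h (X i \<omega>)" using r(2) by (intro h_less) simp
        also have "h (X i \<omega>) \<le> G (insert i C) \<omega>" unfolding G_def by (intro SUP_upper) simp
        finally show False using le by simp
      qed
    qed
  qed
  show thesis
  proof (rule that[OF C])
    have least: "AE \<omega> in M. (\<Squnion>i\<in>C. ereal (X i \<omega>)) \<le> Y \<omega>"
      if Y: "\<forall>i\<in>I. AE \<omega> in M. ereal (X i \<omega>) \<le> Y \<omega>" for Y
    proof -
      have "AE \<omega> in M. \<forall>i\<in>C. ereal (X i \<omega>) \<le> Y \<omega>"
        using Y C by (intro AE_ball_countable') auto
      then show ?thesis by eventually_elim (auto intro: SUP_least)
    qed
    have "(\<lambda>\<omega>. \<Squnion>i\<in>C. ereal (X i \<omega>)) \<in> borel_measurable M"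
      using C X by (intro borel_measurable_SUP) auto
    then show "is_ess_sup M I X (\<lambda>\<omega>. \<Squnion>i\<in>C. ereal (X i \<omega>))"
      unfolding is_ess_sup_def using dominates least by blast
  qed
qed

lemma is_ess_sup_ess_sup:
  assumes "finite_measure M" "\<And>i. i \<in> I \<Longrightarrow> X i \<in> borel_measurable M"
  shows "is_ess_sup M I X (ess_sup M I X)"
  unfolding ess_sup_def by (rule countable_essential_supremum[OF assms]) (auto intro: someI[of "is_ess_sup M I X"])

lemma is_ess_sup_unique:
  assumes "is_ess_sup M I X Y" "is_ess_sup M I X Z"
  shows "AE \<omega> in M. Y \<omega> = Z \<omega>"
proof -
  have "AE \<omega> in M. Y \<omega> \<le> Z \<omega>" "AE \<omega> in M. Z \<omega> \<le> Y \<omega>"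
    using assms by (auto simp: is_ess_sup_def)
  then show ?thesis by eventually_elim auto
qed

lemma Lp_between:
  assumes f: "f \<in> Lp M p" and g: "g \<in> Lp M p" and h: "h \<in> borel_measurable M"
    and between: "AE \<omega> in M. f \<omega> \<le> h \<omega> \<and> h \<omega> \<le> g \<omega>"
  shows "h \<in> Lp M p"
proof (cases "p = \<infinity>")
  case True
  have [measurable]: "f \<in> borel_measurable M" "g \<in> borel_measurable M"
    using f g by (auto simp: Lp_def)
  note [measurable] = h
  define c where "c = max (esssup M (\<lambda>\<omega>. ereal \<bar>f \<omega>\<bar>)) (esssup M (\<lambda>\<omega>. ereal \<bar>g \<omega>\<bar>))"
  have "AE \<omega> in M. ereal \<bar>h \<omega>\<bar> \<le> c"
    using between esssup_AE[where M=M and f="\<lambda>\<omega>. ereal \<bar>f \<omega>\<bar>"] esssup_AE[where M=M and f="\<lambda>\<omega>. ereal \<bar>g \<omega>\<bar>"]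
  proof eventually_elim
    case (elim \<omega>)
    have "\<bar>h \<omega>\<bar> \<le> max \<bar>f \<omega>\<bar> \<bar>g \<omega>\<bar>" using elim(1) by linarith
    then have "ereal \<bar>h \<omega>\<bar> \<le> max (ereal \<bar>f \<omega>\<bar>) (ereal \<bar>g \<omega>\<bar>)" by (auto simp: max_def split: if_splits)
    also have "\<dots> \<le> c" unfolding c_def using elim by (intro max.mono)
    finally show ?case .
  qed
  then have "esssup M (\<lambda>\<omega>. ereal \<bar>h \<omega>\<bar>) \<le> c" by (intro esssup_I) auto
  also have "c < \<infinity>" using f g True by (simp add: c_def Lp_def max_def)
  finally show ?thesis using True h by (simp add: Lp_def)
next
  case False
  have int: "integrable M (\<lambda>\<omega>. \<bar>f \<omega>\<bar> powr enn2real p + \<bar>g \<omega>\<bar> powr enn2real p)"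
    using f g False by (auto simp: Lp_def)
  have "integrable M (\<lambda>\<omega>. \<bar>h \<omega>\<bar> powr enn2real p)"
  proof (rule Bochner_Integration.integrable_bound[OF int])
    show "(\<lambda>\<omega>. \<bar>h \<omega>\<bar> powr enn2real p) \<in> borel_measurable M" using h by measurable
    show "AE \<omega> in M. norm (\<bar>h \<omega>\<bar> powr enn2real p) \<le> norm (\<bar>f \<omega>\<bar> powr enn2real p + \<bar>g \<omega>\<bar> powr enn2real p)"
      using between
    proof eventually_elim
      case (elim \<omega>)
      have "\<bar>h \<omega>\<bar> \<le> \<bar>f \<omega>\<bar> \<or> \<bar>h \<omega>\<bar> \<le> \<bar>g \<omega>\<bar>" using elim by linarith
      then have "\<bar>h \<omega>\<bar> powr enn2real p \<le> \<bar>f \<omega>\<bar> powr enn2real p \<or> \<bar>h \<omega>\<bar> powr enn2real p \<le> \<bar>g \<omega>\<bar> powr enn2real p"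
        by (auto intro: powr_mono2)
      moreover have "0 \<le> \<bar>h \<omega>\<bar> powr enn2real p" "0 \<le> \<bar>f \<omega>\<bar> powr enn2real p" "0 \<le> \<bar>g \<omega>\<bar> powr enn2real p" by auto
      ultimately show ?case unfolding real_norm_def by linarith
    qed
  qed
  then show ?thesis using False h by (simp add: Lp_def)
qed

section \<open>Null sets and the \<open>\<sigma>\<close>-algebras of stopping times\<close>

context bermudan_setting
begin

text \<open>
  The symmetric difference is a null set, and by completeness every null set belongs to \<open>F 0\<close>. This
  is why \<open>t\<close> is nonnegative here; for \<open>t < 0\<close> the events \<open>{\<tau> \<le> t}\<close> are empty.
\<close>

lemma F_sets_AE_cong:
  assumes A: "A \<in> sets (F t)" and t: "0 \<le> t" and B: "B \<subseteq> space M"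
    and AE: "AE \<omega> in M. \<omega> \<in> A \<longleftrightarrow> \<omega> \<in> B"
  shows "B \<in> sets (F t)"
proof -
  have "A \<subseteq> space M" using sets.sets_into_space[OF A] by (simp add: space_F)
  then have "A - B \<in> null_sets M" "B - A \<in> null_sets M"
    using AE B unfolding null_sets_iff_AE by (auto elim: eventually_mono)
  then have "A - B \<in> sets (F t)" "B - A \<in> sets (F t)"
    using F_complete sets_F_mono[OF t] by blast+
  then have "(A - (A - B)) \<union> (B - A) \<in> sets (F t)" using A by auto
  also have "(A - (A - B)) \<union> (B - A) = B" by auto
  finally show ?thesis .
qed

lemma space_sets_F: "space M \<in> sets (F t)"
  using sets.top[of "F t"] by (simp add: space_F)

lemma sublevel_sets_F: "stopping_time F \<tau> \<Longrightarrow> {\<omega> \<in> space M. \<tau> \<omega> \<le> t} \<in> sets (F t)"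
  using stopping_timeD[of F \<tau> t] by (simp add: pred_def space_F)

lemma stopping_timeI_sets:
  "(\<And>t. {\<omega> \<in> space M. \<tau> \<omega> \<le> t} \<in> sets (F t)) \<Longrightarrow> stopping_time F \<tau>"
  by (rule stopping_timeI) (simp add: pred_def space_F)

lemma pre_sigma_AE_cong:
  assumes \<tau>: "stopping_time F \<tau>" "\<tau> \<in> space M \<rightarrow> {0..T}" and A: "A \<in> sets (pre_sigma \<tau>)"
    and B: "B \<subseteq> space M" and AE: "AE \<omega> in M. \<omega> \<in> A \<longleftrightarrow> \<omega> \<in> B"
  shows "B \<in> sets (pre_sigma \<tau>)"
proof (rule sets_pre_sigmaI[OF \<tau>(1)])
  fix t
  show "{\<omega> \<in> B. \<tau> \<omega> \<le> t} \<in> sets (F t)"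
  proof (cases "0 \<le> t")
    case True
    show ?thesis
      by (rule F_sets_AE_cong[OF sets_pre_sigmaD[OF \<tau>(1) A, of t] True])
         (use B AE in \<open>auto elim: eventually_mono\<close>)
  next
    case False
    then have "{\<omega> \<in> B. \<tau> \<omega> \<le> t} = {}" using \<tau>(2) B by (force simp: Pi_iff)
    then show ?thesis by (simp only: sets.empty_sets)
  qed
qed

text \<open>
  The order between Bermudan strategies holds only almost surely, so that the pointwise monotonicity
  of \<open>pre_sigma\<close> has to be relaxed by a null set.
\<close>

lemma pre_sigma_AE_mono:
  assumes \<sigma>: "stopping_time F \<sigma>" and \<tau>: "stopping_time F \<tau>" "\<tau> \<in> space M \<rightarrow> {0..T}"
    and le: "AE \<omega> in M. \<sigma> \<omega> \<le> \<tau> \<omega>" and A: "A \<in> sets (pre_sigma \<sigma>)"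
  shows "A \<in> sets (pre_sigma \<tau>)"
proof (rule sets_pre_sigmaI[OF \<tau>(1)])
  fix t
  have A_space: "A \<subseteq> space M" using sets.sets_into_space[OF A] by (simp add: space_pre_sigma)
  show "{\<omega> \<in> A. \<tau> \<omega> \<le> t} \<in> sets (F t)"
  proof (cases "0 \<le> t")
    case True
    have "{\<omega> \<in> A. \<sigma> \<omega> \<le> t} \<inter> {\<omega> \<in> space M. \<tau> \<omega> \<le> t} \<in> sets (F t)"
      using sets_pre_sigmaD[OF \<sigma> A, of t] sublevel_sets_F[OF \<tau>(1), of t] by auto
    then show ?thesis
      by (rule F_sets_AE_cong[OF _ True])
         (use A_space le in \<open>auto elim!: eventually_mono\<close>)
  next
    case False
    then have "{\<omega> \<in> A. \<tau> \<omega> \<le> t} = {}" using \<tau>(2) A_space by (force simp: Pi_iff)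
    then show ?thesis by (simp only: sets.empty_sets)
  qed
qed

lemma pre_sigma_subset:
  assumes "stopping_time F \<tau>" "\<tau> \<in> space M \<rightarrow> {0..T}"
  shows "sets (pre_sigma \<tau>) \<subseteq> sets (F T)" "sets (pre_sigma \<tau>) \<subseteq> sets M"
proof -
  show *: "sets (pre_sigma \<tau>) \<subseteq> sets (F T)"
  proof
    fix A assume A: "A \<in> sets (pre_sigma \<tau>)"
    have "A \<subseteq> space M" using sets.sets_into_space[OF A] by (simp add: space_pre_sigma)
    then have "{\<omega> \<in> A. \<tau> \<omega> \<le> T} = A" using assms by auto
    then show "A \<in> sets (F T)" using sets_pre_sigmaD[OF assms(1) A, of T] by simp
  qed
  show "sets (pre_sigma \<tau>) \<subseteq> sets M"
    using * F_subset[of T] T_pos by auto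
qed

text \<open>
  Needed because \<^const>\<open>ess_sup\<close> picks an arbitrary version, about which only measurability with
  respect to \<open>M\<close> is known.
\<close>

lemma borel_measurable_pre_sigma_AE_cong:
  assumes \<tau>: "stopping_time F \<tau>" "\<tau> \<in> space M \<rightarrow> {0..T}"
    and f: "f \<in> borel_measurable (pre_sigma \<tau>)" and AE: "AE \<omega> in M. f \<omega> = g \<omega>"
  shows "g \<in> borel_measurable (pre_sigma \<tau>)"
proof (rule measurableI)
  fix Y :: "'b set" assume "Y \<in> sets borel"
  then have "f -` Y \<inter> space M \<in> sets (pre_sigma \<tau>)"
    using measurable_sets[OF f] by (simp add: space_pre_sigma)
  then show "g -` Y \<inter> space (pre_sigma \<tau>) \<in> sets (pre_sigma \<tau>)"
    by (rule pre_sigma_AE_cong[OF \<tau>]) (use AE in \<open>auto simp: space_pre_sigma elim: eventually_mono\<close>)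
qed simp

text \<open>
  On \<open>{\<sigma> \<le> t, \<tau> \<le> t}\<close> equality is the failure of both strict inequalities, and each strict
  inequality is an event of the \<open>\<sigma>\<close>-algebra of its smaller side.
\<close>

lemma equality_set_pre_sigma:
  assumes \<sigma>: "stopping_time F \<sigma>" and \<tau>: "stopping_time F \<tau>"
  shows "{\<omega> \<in> space M. \<sigma> \<omega> = \<tau> \<omega>} \<in> sets (pre_sigma \<sigma>)"
proof (rule sets_pre_sigmaI[OF \<sigma>])
  fix t
  have lt: "{\<omega> \<in> space M. f \<omega> < g \<omega> \<and> f \<omega> \<le> t} \<in> sets (F t)"
    if f: "stopping_time F f" and g: "stopping_time F g" for f g
    using sets_pre_sigmaD[OF f stopping_time_less[OF f g, unfolded pred_def], of t]
    by (simp add: space_pre_sigma conj_assoc)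
  have "{\<omega> \<in> {\<omega> \<in> space M. \<sigma> \<omega> = \<tau> \<omega>}. \<sigma> \<omega> \<le> t} =
      {\<omega> \<in> space M. \<sigma> \<omega> \<le> t} \<inter> {\<omega> \<in> space M. \<tau> \<omega> \<le> t}
      - {\<omega> \<in> space M. \<sigma> \<omega> < \<tau> \<omega> \<and> \<sigma> \<omega> \<le> t} - {\<omega> \<in> space M. \<tau> \<omega> < \<sigma> \<omega> \<and> \<tau> \<omega> \<le> t}"
    by auto
  then show "{\<omega> \<in> {\<omega> \<in> space M. \<sigma> \<omega> = \<tau> \<omega>}. \<sigma> \<omega> \<le> t} \<in> sets (F t)"
    by (simp only:) (intro sets.Diff sets.Int sublevel_sets_F lt \<sigma> \<tau>)
qed

section \<open>Closure properties of Bermudan strategies\<close>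

lemma suminf_indicator_unique:
  fixes f :: "nat \<Rightarrow> real"
  assumes "\<omega> \<in> A k" "\<And>j. \<omega> \<in> A j \<Longrightarrow> j = k"
  shows "(\<Sum>j. f j * indicator (A j) \<omega>) = f k"
proof -
  have "(\<Sum>j. f j * indicator (A j) \<omega>) = (\<Sum>j\<in>{k}. f j * indicator (A j) \<omega>)"
    by (rule suminf_finite) (auto simp: indicator_def dest: assms(2))
  then show ?thesis using assms(1) by simp
qed

text \<open>
  The partition can be recovered from the values: \<open>A k\<close> is the event that \<open>k\<close> is the first index with
  \<open>\<theta>\<^sub>k = \<tau>\<close>. It belongs to \<open>\<F>\<close> at time \<open>\<theta>\<^sub>k\<close> since on \<open>{\<theta>\<^sub>k = \<tau>}\<close> the equation \<open>\<theta>\<^sub>j = \<tau>\<close> means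
  \<open>\<theta>\<^sub>j = \<theta>\<^sub>k\<close>. In this form membership in \<^const>\<open>Theta\<close> is stable under every operation that yields
  a stopping time and selects pointwise among given strategies.
\<close>

lemma Theta_iff:
  "\<tau> \<in> Theta \<longleftrightarrow> stopping_time F \<tau> \<and> \<tau> \<in> space M \<rightarrow> {0..T} \<and>
     (AE \<omega> in M. \<tau> \<omega> = T \<or> (\<exists>k. \<tau> \<omega> = \<theta> k \<omega>))"
proof (intro iffI conjI)
  assume "\<tau> \<in> Theta"
  then obtain A A' where "stopping_time F \<tau>" "\<tau> \<in> space M \<rightarrow> {0..T}"
    and part: "AE \<omega> in M. (\<omega> \<notin> A' \<and> (\<exists>!k. \<omega> \<in> A k)) \<or> (\<omega> \<in> A' \<and> (\<forall>k. \<omega> \<notin> A k))"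
    and eq: "AE \<omega> in M. \<tau> \<omega> = (\<Sum>k. \<theta> k \<omega> * indicator (A k) \<omega>) + T * indicator A' \<omega>"
    by (auto simp: Theta_def)
  then show "stopping_time F \<tau>" "\<tau> \<in> space M \<rightarrow> {0..T}" by auto
  show "AE \<omega> in M. \<tau> \<omega> = T \<or> (\<exists>k. \<tau> \<omega> = \<theta> k \<omega>)"
    using part eq
  proof eventually_elim
    case (elim \<omega>)
    show ?case
    proof (cases "\<omega> \<in> A'")
      case True then show ?thesis using elim by (auto simp: indicator_def)
    next
      case False
      then obtain k where k: "\<omega> \<in> A k" "\<And>j. \<omega> \<in> A j \<Longrightarrow> j = k" using elim by auto
      have "(\<Sum>j. \<theta> j \<omega> * indicator (A j) \<omega>) = \<theta> k \<omega>"
        by (rule suminf_indicator_unique[where A=A, OF k])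
      then show ?thesis using elim(2) False by auto
    qed
  qed
next
  assume *: "stopping_time F \<tau> \<and> \<tau> \<in> space M \<rightarrow> {0..T} \<and>
     (AE \<omega> in M. \<tau> \<omega> = T \<or> (\<exists>k. \<tau> \<omega> = \<theta> k \<omega>))"
  define A where "A k = {\<omega> \<in> space M. \<theta> k \<omega> = \<tau> \<omega>} - (\<Union>j<k. {\<omega> \<in> space M. \<theta> k \<omega> = \<theta> j \<omega>})" for k
  define A' where "A' = space M - (\<Union>k. {\<omega> \<in> space M. \<theta> k \<omega> = \<tau> \<omega>})"
  have A_meas: "A k \<in> sets (pre_sigma (\<theta> k))" for k
    unfolding A_def using * theta_stopping_time
    by (intro sets.Diff sets.finite_UN equality_set_pre_sigma) auto
  have "{\<omega> \<in> space M. \<theta> k \<omega> = \<tau> \<omega>} \<in> sets (F T)" for k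
    using equality_set_pre_sigma[of "\<theta> k" \<tau>] * theta_stopping_time[of k] pre_sigma_subset(1)[of "\<theta> k"] theta_range[of k]
    by auto
  then have A'_meas: "A' \<in> sets (F T)"
    unfolding A'_def using space_sets_F[of T] by auto
  have first: "\<exists>!k. \<omega> \<in> A k" if \<omega>: "\<omega> \<in> space M" "\<theta> n \<omega> = \<tau> \<omega>" for \<omega> n
  proof -
    define k where "k = (LEAST k. \<theta> k \<omega> = \<tau> \<omega>)"
    have k: "\<theta> k \<omega> = \<tau> \<omega>" "\<And>j. j < k \<Longrightarrow> \<theta> j \<omega> \<noteq> \<tau> \<omega>"
      unfolding k_def by (rule LeastI[of _ n], rule \<omega>(2)) (rule not_less_Least)
    show ?thesis
    proof (rule ex1I[of _ k])
      show "\<omega> \<in> A k" using k(1) \<omega>(1) by (auto simp: A_def dest: k(2))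
      fix j assume j: "\<omega> \<in> A j"
      then have "\<theta> j \<omega> = \<tau> \<omega>" by (simp add: A_def)
      moreover have "\<theta> i \<omega> \<noteq> \<tau> \<omega>" if "i < j" for i
        using j that by (force simp: A_def)
      ultimately show "j = k" using k by (metis linorder_neqE_nat)
    qed
  qed
  have part: "(\<omega> \<notin> A' \<and> (\<exists>!k. \<omega> \<in> A k)) \<or> (\<omega> \<in> A' \<and> (\<forall>k. \<omega> \<notin> A k))" if "\<omega> \<in> space M" for \<omega>
  proof (cases "\<exists>n. \<theta> n \<omega> = \<tau> \<omega>")
    case True
    then have "\<exists>!k. \<omega> \<in> A k" using first[OF that] by blast
    moreover have "\<omega> \<notin> A'" using True that by (auto simp: A'_def)
    ultimately show ?thesis by blast
  next
    case False
    then show ?thesis using that by (auto simp: A'_def A_def)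
  qed
  have sum: "AE \<omega> in M. \<tau> \<omega> = (\<Sum>k. \<theta> k \<omega> * indicator (A k) \<omega>) + T * indicator A' \<omega>"
    using conjunct2[OF conjunct2[OF *]] AE_space
  proof eventually_elim
    case (elim \<omega>)
    show ?case
    proof (cases "\<omega> \<in> A'")
      case True
      then have "\<omega> \<notin> A k" for k by (auto simp: A'_def A_def)
      then show ?thesis using True elim by (auto simp: A'_def)
    next
      case False
      then obtain k where k: "\<omega> \<in> A k" "\<And>j. \<omega> \<in> A j \<Longrightarrow> j = k" using part elim by metis
      have "(\<Sum>j. \<theta> j \<omega> * indicator (A j) \<omega>) = \<theta> k \<omega>"
        by (rule suminf_indicator_unique[where A=A, OF k])
      moreover have "\<theta> k \<omega> = \<tau> \<omega>" using k(1) by (simp add: A_def)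
      ultimately show ?thesis using False by simp
    qed
  qed
  show "\<tau> \<in> Theta"
    unfolding Theta_def mem_Collect_eq
    by (intro conjI exI[of _ A] exI[of _ A'] allI A_meas A'_meas sum AE_I2[OF part])
       (simp_all add: conjunct1[OF *] conjunct1[OF conjunct2[OF *]])
qed

lemma Theta_stopping_time: "\<tau> \<in> Theta \<Longrightarrow> stopping_time F \<tau>"
  and Theta_range: "\<tau> \<in> Theta \<Longrightarrow> \<tau> \<in> space M \<rightarrow> {0..T}"
  by (auto simp: Theta_iff)

lemma Theta_selection:
  assumes I: "finite I" "\<And>i. i \<in> I \<Longrightarrow> \<tau> i \<in> Theta"
    and \<sigma>: "stopping_time F \<sigma>" and sel: "\<And>\<omega>. \<exists>i\<in>I. \<sigma> \<omega> = \<tau> i \<omega>"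
  shows "\<sigma> \<in> Theta"
proof -
  have "AE \<omega> in M. \<forall>i\<in>I. \<tau> i \<omega> = T \<or> (\<exists>k. \<tau> i \<omega> = \<theta> k \<omega>)"
    using I by (intro AE_finite_allI) (auto simp: Theta_iff)
  then have "AE \<omega> in M. \<sigma> \<omega> = T \<or> (\<exists>k. \<sigma> \<omega> = \<theta> k \<omega>)"
    by eventually_elim (metis sel)
  moreover have "\<sigma> \<in> space M \<rightarrow> {0..T}"
  proof
    fix \<omega> assume "\<omega> \<in> space M"
    moreover obtain i where "i \<in> I" "\<sigma> \<omega> = \<tau> i \<omega>" using sel by blast
    ultimately show "\<sigma> \<omega> \<in> {0..T}" using Theta_range[OF I(2)] by (metis PiE)
  qed
  ultimately show ?thesis using \<sigma> by (simp add: Theta_iff)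
qed

lemma vsup_Theta:
  assumes "1 \<le> n" "\<And>i. i \<in> {1..n} \<Longrightarrow> \<tau> i \<in> Theta"
  shows "vsup n \<tau> \<in> Theta"
proof (rule Theta_selection[of "{1..n}" \<tau>])
  have "{\<omega> \<in> space M. vsup n \<tau> \<omega> \<le> t} = (\<Inter>i\<in>{1..n}. {\<omega> \<in> space M. \<tau> i \<omega> \<le> t})" for t
    using assms(1) by (auto simp: vsup_def)
  then show "stopping_time F (vsup n \<tau>)"
    using assms by (intro stopping_timeI_sets) (auto intro!: sets.finite_INT sublevel_sets_F Theta_stopping_time)
  show "\<exists>i\<in>{1..n}. vsup n \<tau> \<omega> = \<tau> i \<omega>" for \<omega>
    using Max_in[of "(\<lambda>i. \<tau> i \<omega>) ` {1..n}"] assms(1) unfolding vsup_def by fastforce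
qed (use assms in auto)

lemma vinf_Theta:
  assumes "1 \<le> n" "\<And>i. i \<in> {1..n} \<Longrightarrow> \<tau> i \<in> Theta"
  shows "vinf n \<tau> \<in> Theta"
proof (rule Theta_selection[of "{1..n}" \<tau>])
  have "{\<omega> \<in> space M. vinf n \<tau> \<omega> \<le> t} = (\<Union>i\<in>{1..n}. {\<omega> \<in> space M. \<tau> i \<omega> \<le> t})" for t
    using assms(1) by (auto simp: vinf_def Min_le_iff)
  then show "stopping_time F (vinf n \<tau>)"
    using assms by (intro stopping_timeI_sets) (auto intro!: sets.finite_UN sublevel_sets_F Theta_stopping_time)
  show "\<exists>i\<in>{1..n}. vinf n \<tau> \<omega> = \<tau> i \<omega>" for \<omega>
    using Min_in[of "(\<lambda>i. \<tau> i \<omega>) ` {1..n}"] assms(1) unfolding vinf_def by fastforce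
qed (use assms in auto)

lemma vsup_ge: "i \<in> {1..n} \<Longrightarrow> \<tau> i \<omega> \<le> vsup n \<tau> \<omega>"
  unfolding vsup_def by (rule Max_ge) auto

lemma vinf_le: "i \<in> {1..n} \<Longrightarrow> vinf n \<tau> \<omega> \<le> \<tau> i \<omega>"
  unfolding vinf_def by (rule Min_le) auto

lemma vinf_eqI:
  "i \<in> {1..n} \<Longrightarrow> \<tau> i \<omega> = m \<Longrightarrow> (\<And>j. j \<in> {1..n} \<Longrightarrow> m \<le> \<tau> j \<omega>) \<Longrightarrow> vinf n \<tau> \<omega> = m"
  unfolding vinf_def by (rule Min_eqI) auto

text \<open>
  Since \<open>\<eta>\<^sub>i \<ge> \<sigma>\<close>, the event \<open>B\<^sub>i \<inter> {\<eta>\<^sub>i \<le> t}\<close> is almost surely \<open>(B\<^sub>i \<inter> {\<sigma> \<le> t}) \<inter> {\<eta>\<^sub>i \<le> t}\<close>, and the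
  bracket belongs to \<open>F t\<close> because \<open>B\<^sub>i\<close> is known at time \<open>\<sigma>\<close>.
\<close>

lemma pasting_Theta:
  assumes \<sigma>: "\<sigma> \<in> Theta" and I: "finite I"
    and B: "\<And>i. i \<in> I \<Longrightarrow> B i \<in> sets (pre_sigma \<sigma>)" and cover: "AE \<omega> in M. \<exists>i\<in>I. \<omega> \<in> B i"
    and \<eta>: "\<And>i. i \<in> I \<Longrightarrow> \<eta> i \<in> Theta_from \<sigma>"
    and \<tau>: "\<tau> \<in> space M \<rightarrow> {0..T}" "\<And>i. i \<in> I \<Longrightarrow> AE \<omega> in M. \<omega> \<in> B i \<longrightarrow> \<tau> \<omega> = \<eta> i \<omega>"
  shows "\<tau> \<in> Theta_from \<sigma>"
proof -
  have \<eta>_Theta: "\<eta> i \<in> Theta" "AE \<omega> in M. \<sigma> \<omega> \<le> \<eta> i \<omega>" if "i \<in> I" for i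
    using \<eta>[OF that] by (auto simp: Theta_from_def)
  have eq: "AE \<omega> in M. \<forall>i\<in>I. \<omega> \<in> B i \<longrightarrow> \<tau> \<omega> = \<eta> i \<omega>"
    using I \<tau>(2) by (intro AE_finite_allI) auto
  have ge: "AE \<omega> in M. \<forall>i\<in>I. \<sigma> \<omega> \<le> \<eta> i \<omega>"
    using I \<eta>_Theta(2) by (intro AE_finite_allI) auto
  have val: "AE \<omega> in M. \<forall>i\<in>I. \<eta> i \<omega> = T \<or> (\<exists>k. \<eta> i \<omega> = \<theta> k \<omega>)"
    using I \<eta>_Theta(1) by (intro AE_finite_allI) (auto simp: Theta_iff)
  have "stopping_time F \<tau>"
  proof (rule stopping_timeI_sets)
    fix t
    show "{\<omega> \<in> space M. \<tau> \<omega> \<le> t} \<in> sets (F t)"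
    proof (cases "0 \<le> t")
      case True
      let ?A = "\<Union>i\<in>I. {\<omega> \<in> B i. \<sigma> \<omega> \<le> t} \<inter> {\<omega> \<in> space M. \<eta> i \<omega> \<le> t}"
      show ?thesis
      proof (rule F_sets_AE_cong[OF _ True])
        show "?A \<in> sets (F t)"
          using I by (intro sets.finite_UN sets.Int sublevel_sets_F sets_pre_sigmaD B
              Theta_stopping_time[OF \<sigma>] Theta_stopping_time[OF \<eta>_Theta(1)])
        show "AE \<omega> in M. \<omega> \<in> ?A \<longleftrightarrow> \<omega> \<in> {\<omega> \<in> space M. \<tau> \<omega> \<le> t}"
          using cover eq ge AE_space by eventually_elim fastforce
      qed auto
    next
      case False
      then have "{\<omega> \<in> space M. \<tau> \<omega> \<le> t} = {}" using \<tau>(1) by (force simp: Pi_iff)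
      then show ?thesis by (simp only: sets.empty_sets)
    qed
  qed
  moreover have "AE \<omega> in M. \<tau> \<omega> = T \<or> (\<exists>k. \<tau> \<omega> = \<theta> k \<omega>)"
    using cover eq val by eventually_elim force
  moreover have "AE \<omega> in M. \<sigma> \<omega> \<le> \<tau> \<omega>"
    using cover eq ge by eventually_elim force
  ultimately show ?thesis using \<tau>(1) by (simp add: Theta_from_def Theta_iff)
qed

lemma Theta_from_self: "S \<in> Theta \<Longrightarrow> S \<in> Theta_from S"
  by (simp add: Theta_from_def)

lemma Theta_from_Theta: "\<tau> \<in> Theta_from S \<Longrightarrow> \<tau> \<in> Theta"
  by (simp add: Theta_from_def)

lemma Theta_from_trans:
  assumes "\<tau> \<in> Theta_from \<sigma>" "\<sigma> \<in> Theta_from S"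
  shows "\<tau> \<in> Theta_from S"
proof -
  have "AE \<omega> in M. S \<omega> \<le> \<sigma> \<omega>" "AE \<omega> in M. \<sigma> \<omega> \<le> \<tau> \<omega>"
    using assms by (auto simp: Theta_from_def)
  then have "AE \<omega> in M. S \<omega> \<le> \<tau> \<omega>" by eventually_elim simp
  then show ?thesis using assms by (simp add: Theta_from_def)
qed

lemma Lp_at_measurable: "\<eta> \<in> Lp_at p \<tau> \<Longrightarrow> \<eta> \<in> borel_measurable M"
  by (auto simp: Lp_at_def Lp_def)

end

section \<open>Value functions of the multiple stopping problem\<close>

locale multiple_stopping_problem = nonlinear_stopping M F T \<theta> p d \<rho>
  for M :: "'a measure" and F :: "real \<Rightarrow> 'a measure" and T :: real
    and \<theta> :: "nat \<Rightarrow> 'a \<Rightarrow> real" and p :: ennreal and d :: nat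
    and \<rho> :: "('a \<Rightarrow> real) \<Rightarrow> ('a \<Rightarrow> real) \<Rightarrow> ('a \<Rightarrow> real) \<Rightarrow> 'a \<Rightarrow> real" +
  fixes \<psi> :: "(nat \<Rightarrow> 'a \<Rightarrow> real) \<Rightarrow> 'a \<Rightarrow> real"
  assumes psi_admissible: "d_admissible d \<psi>"
    and psi_integrable: "d_p_integrable p d \<psi>"
    and V_Lp: "\<And>R. R \<in> Theta \<Longrightarrow> ereal_in_Lp M p (V \<psi> R)"
begin

lemma d_ge_1: "1 \<le> d"
  using d_ge_2 by simp

lemma psi_Lp_at: "\<tau> \<in> {1..d} \<rightarrow>\<^sub>E Theta \<Longrightarrow> \<psi> \<tau> \<in> Lp_at p (vsup d \<tau>)"
  using psi_admissible psi_integrable by (auto simp: Lp_at_def d_admissible_def d_p_integrable_def)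

lemma vsup_vector_Theta: "\<tau> \<in> {1..d} \<rightarrow>\<^sub>E Theta \<Longrightarrow> vsup d \<tau> \<in> Theta"
  by (rule vsup_Theta[OF d_ge_1]) auto

lemma vinf_vector_Theta: "\<tau> \<in> {1..d} \<rightarrow>\<^sub>E Theta \<Longrightarrow> vinf d \<tau> \<in> Theta"
  by (rule vinf_Theta[OF d_ge_1]) auto

lemma PiE_Theta_from_Theta: "\<tau> \<in> I \<rightarrow>\<^sub>E Theta_from S \<Longrightarrow> \<tau> \<in> I \<rightarrow>\<^sub>E Theta"
  using Theta_from_Theta by (auto simp: PiE_iff)

lemma fun_upd_PiE_Theta_from:
  assumes "S \<in> Theta" "i \<in> {1..d}" "\<tau> \<in> ({1..d} - {i}) \<rightarrow>\<^sub>E Theta_from S"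
  shows "\<tau>(i := S) \<in> {1..d} \<rightarrow>\<^sub>E Theta_from S"
  using assms Theta_from_self by (auto simp: PiE_iff extensional_def)

lemma reward_Lp_at: "S \<in> Theta \<Longrightarrow> \<tau> \<in> {1..d} \<rightarrow>\<^sub>E Theta \<Longrightarrow> reward \<psi> S \<tau> \<in> Lp_at p S"
  unfolding reward_def by (intro rho_Lp psi_Lp_at vsup_vector_Theta)

lemma rho_AE_cong:
  assumes "S \<in> Theta" "\<tau> \<in> Theta" "\<eta>1 \<in> Lp_at p \<tau>" "\<eta>2 \<in> Lp_at p \<tau>" and eq: "AE \<omega> in M. \<eta>1 \<omega> = \<eta>2 \<omega>"
  shows "AE \<omega> in M. \<rho> S \<tau> \<eta>1 \<omega> = \<rho> S \<tau> \<eta>2 \<omega>"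
proof -
  have "AE \<omega> in M. \<eta>1 \<omega> \<le> \<eta>2 \<omega>" "AE \<omega> in M. \<eta>2 \<omega> \<le> \<eta>1 \<omega>"
    using eq by (auto elim: eventually_mono)
  from monotonicity[OF assms(1-4) this(1)] monotonicity[OF assms(1,2,4,3) this(2)]
  show ?thesis by eventually_elim simp
qed

lemma V_is_ess_sup:
  "S \<in> Theta \<Longrightarrow> is_ess_sup M ({1..d} \<rightarrow>\<^sub>E Theta_from S) (reward \<psi> S) (V \<psi> S)"
  unfolding V_def
  by (intro is_ess_sup_ess_sup finite_measure_axioms Lp_at_measurable[OF reward_Lp_at]
      PiE_Theta_from_Theta)

lemma u_coord_is_ess_sup:
  assumes "S \<in> Theta" "i \<in> {1..d}"
  shows "is_ess_sup M (({1..d} - {i}) \<rightarrow>\<^sub>E Theta_from S) (\<lambda>\<tau>. reward \<psi> S (\<tau>(i := S))) (u_coord \<psi> i S)"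
  unfolding u_coord_def
  by (intro is_ess_sup_ess_sup finite_measure_axioms Lp_at_measurable[OF reward_Lp_at]
      PiE_Theta_from_Theta[OF fun_upd_PiE_Theta_from[OF assms]] assms)

text \<open>
  Up to a null set \<^const>\<open>u_coord\<close> is a countable supremum of \<open>\<F>\<^sub>S\<close>-measurable rewards, and null sets
  are events of \<open>\<F>\<^sub>S\<close>.
\<close>

lemma u_coord_measurable:
  assumes S: "S \<in> Theta" and i: "i \<in> {1..d}"
  shows "u_coord \<psi> i S \<in> borel_measurable (pre_sigma S)"
proof -
  let ?I = "({1..d} - {i}) \<rightarrow>\<^sub>E Theta_from S" and ?X = "\<lambda>\<tau>. reward \<psi> S (\<tau>(i := S))"
  have X: "?X \<tau> \<in> Lp_at p S" if "\<tau> \<in> ?I" for \<tau>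
    by (rule reward_Lp_at[OF S PiE_Theta_from_Theta[OF fun_upd_PiE_Theta_from[OF S i that]]])
  obtain C where C: "countable C" "C \<subseteq> ?I" "is_ess_sup M ?I ?X (\<lambda>\<omega>. \<Squnion>\<tau>\<in>C. ereal (?X \<tau> \<omega>))"
    by (rule countable_essential_supremum[OF finite_measure_axioms Lp_at_measurable[OF X]])
  have "(\<lambda>\<omega>. \<Squnion>\<tau>\<in>C. ereal (?X \<tau> \<omega>)) \<in> borel_measurable (pre_sigma S)"
    using C(1,2) X by (intro borel_measurable_SUP borel_measurable_ereal) (auto simp: Lp_at_def)
  then show ?thesis
    using is_ess_sup_unique[OF C(3) u_coord_is_ess_sup[OF S i]]
    by (rule borel_measurable_pre_sigma_AE_cong[OF Theta_stopping_time[OF S] Theta_range[OF S]])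
qed

lemma reward_le_u_coord:
  assumes "S \<in> Theta" "i \<in> {1..d}" "\<tau> \<in> {1..d} \<rightarrow>\<^sub>E Theta_from S" "\<tau> i = S"
  shows "AE \<omega> in M. ereal (reward \<psi> S \<tau> \<omega>) \<le> u_coord \<psi> i S \<omega>"
proof -
  have "restrict \<tau> ({1..d} - {i}) \<in> ({1..d} - {i}) \<rightarrow>\<^sub>E Theta_from S"
    using assms(3) by auto
  moreover have "(restrict \<tau> ({1..d} - {i}))(i := S) = \<tau>"
    using assms(2-4) by (auto simp: fun_eq_iff PiE_iff extensional_def)
  ultimately show ?thesis
    using u_coord_is_ess_sup[OF assms(1,2)] unfolding is_ess_sup_def by fastforce
qed

lemma u_coord_le_V:
  assumes S: "S \<in> Theta" and i: "i \<in> {1..d}"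
  shows "AE \<omega> in M. u_coord \<psi> i S \<omega> \<le> V \<psi> S \<omega>"
proof -
  have "AE \<omega> in M. ereal (reward \<psi> S (\<tau>(i := S)) \<omega>) \<le> V \<psi> S \<omega>"
    if "\<tau> \<in> ({1..d} - {i}) \<rightarrow>\<^sub>E Theta_from S" for \<tau>
    using V_is_ess_sup[OF S] fun_upd_PiE_Theta_from[OF S i that] by (simp add: is_ess_sup_def)
  then show ?thesis
    using V_is_ess_sup[OF S] u_coord_is_ess_sup[OF S i] by (simp add: is_ess_sup_def)
qed

lemma u_coord_le_phi: "i \<in> {1..d} \<Longrightarrow> u_coord \<psi> i S \<omega> \<le> phi \<psi> S \<omega>"
  unfolding phi_def by (rule Max_ge) auto

text \<open>
  The reward of stopping all components at \<open>S\<close> bounds \<^const>\<open>phi\<close> from below and \<^const>\<open>V\<close> bounds it from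
  above. Both bounds are almost surely finite, so the convention that \<^const>\<open>real_of_ereal\<close> sends infinite
  values to \<open>0\<close> takes effect only on a null set.
\<close>

lemma phi_real_Lp_at:
  assumes S: "S \<in> Theta"
  shows "AE \<omega> in M. phi \<psi> S \<omega> = ereal (phi_real \<psi> S \<omega>)" "phi_real \<psi> S \<in> Lp_at p S"
proof -
  define \<sigma> where "\<sigma> = (\<lambda>j\<in>{1..d}. S)"
  have \<sigma>: "\<sigma> \<in> {1..d} \<rightarrow>\<^sub>E Theta_from S" using Theta_from_self[OF S] by (auto simp: \<sigma>_def)
  have lower: "AE \<omega> in M. ereal (reward \<psi> S \<sigma> \<omega>) \<le> u_coord \<psi> 1 S \<omega>"
    using d_ge_1 by (intro reward_le_u_coord S \<sigma>) (auto simp: \<sigma>_def)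
  have upper: "AE \<omega> in M. \<forall>i\<in>{1..d}. u_coord \<psi> i S \<omega> \<le> V \<psi> S \<omega>"
    by (intro AE_finite_allI u_coord_le_V S) auto
  have "AE \<omega> in M. \<bar>V \<psi> S \<omega>\<bar> \<noteq> \<infinity>" using V_Lp[OF S] by (simp add: ereal_in_Lp_def)
  with lower upper have *: "AE \<omega> in M. phi \<psi> S \<omega> = ereal (phi_real \<psi> S \<omega>) \<and>
      reward \<psi> S \<sigma> \<omega> \<le> phi_real \<psi> S \<omega> \<and> phi_real \<psi> S \<omega> \<le> real_of_ereal (V \<psi> S \<omega>)"
  proof eventually_elim
    case (elim \<omega>)
    have "ereal (reward \<psi> S \<sigma> \<omega>) \<le> phi \<psi> S \<omega>"
      using elim(1) u_coord_le_phi[of 1 S \<omega>] d_ge_1 by auto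
    moreover have "phi \<psi> S \<omega> \<le> V \<psi> S \<omega>"
      unfolding phi_def using elim(2) d_ge_1 by (subst Max_le_iff) auto
    ultimately show ?case
      using elim(3) unfolding phi_real_def by (cases "phi \<psi> S \<omega>"; cases "V \<psi> S \<omega>") auto
  qed
  then show "AE \<omega> in M. phi \<psi> S \<omega> = ereal (phi_real \<psi> S \<omega>)" by eventually_elim simp
  have "phi \<psi> S \<in> borel_measurable (pre_sigma S)"
    unfolding phi_def by (intro borel_measurable_Max u_coord_measurable S) auto
  then have meas: "phi_real \<psi> S \<in> borel_measurable (pre_sigma S)"
    unfolding phi_real_def by measurable
  have meas_M: "phi_real \<psi> S \<in> borel_measurable M"
    using meas pre_sigma_subset(2)[OF Theta_stopping_time[OF S] Theta_range[OF S]]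
    unfolding measurable_def by (auto simp: space_pre_sigma)
  have lower_Lp: "reward \<psi> S \<sigma> \<in> Lp M p"
    using reward_Lp_at[OF S PiE_Theta_from_Theta[OF \<sigma>]] by (simp add: Lp_at_def)
  have upper_Lp: "(\<lambda>\<omega>. real_of_ereal (V \<psi> S \<omega>)) \<in> Lp M p"
    using V_Lp[OF S] by (simp add: ereal_in_Lp_def)
  have "AE \<omega> in M. reward \<psi> S \<sigma> \<omega> \<le> phi_real \<psi> S \<omega>
      \<and> phi_real \<psi> S \<omega> \<le> real_of_ereal (V \<psi> S \<omega>)"
    using * by eventually_elim simp
  then have "phi_real \<psi> S \<in> Lp M p"
    by (rule Lp_between[OF lower_Lp upper_Lp meas_M])
  then show "phi_real \<psi> S \<in> Lp_at p S" using meas by (simp add: Lp_at_def)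
qed

lemma u_is_ess_sup:
  "S \<in> Theta \<Longrightarrow> is_ess_sup M (Theta_from S) (\<lambda>\<tau>. \<rho> S \<tau> (phi_real \<psi> \<tau>)) (u \<psi> S)"
  unfolding u_def
  by (intro is_ess_sup_ess_sup finite_measure_axioms Lp_at_measurable[OF rho_Lp]
      phi_real_Lp_at(2)) (auto dest: Theta_from_Theta)

text \<open>
  On the event where the \<open>i\<close>-th component is minimal, replacing it by the minimum \<open>m\<close> changes neither
  the vector nor its minimum. The \<open>d\<close>-property identifies the two values there, and the new vector
  competes in \<open>u\<^sup>(\<^sup>i\<^sup>)(m)\<close>.
\<close>

lemma reward_at_vinf_le_phi:
  assumes \<tau>: "\<tau> \<in> {1..d} \<rightarrow>\<^sub>E Theta"
  shows "AE \<omega> in M. ereal (reward \<psi> (vinf d \<tau>) \<tau> \<omega>) \<le> phi \<psi> (vinf d \<tau>) \<omega>"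
proof -
  define m where "m = vinf d \<tau>"
  have m: "m \<in> Theta" unfolding m_def by (rule vinf_vector_Theta[OF \<tau>])
  have m_le: "m \<omega> \<le> \<tau> i \<omega>" if "i \<in> {1..d}" for i \<omega>
    unfolding m_def by (rule vinf_le[OF that])
  have on_event: "AE \<omega> in M. m \<omega> = \<tau> i \<omega> \<longrightarrow> ereal (reward \<psi> m \<tau> \<omega>) \<le> phi \<psi> m \<omega>"
    if i: "i \<in> {1..d}" for i
  proof -
    let ?A = "{\<omega> \<in> space M. m \<omega> = \<tau> i \<omega>}"
    have \<tau>': "\<tau>(i := m) \<in> {1..d} \<rightarrow>\<^sub>E Theta_from m"
      using \<tau> i m m_le by (auto simp: PiE_iff extensional_def Theta_from_def)
    have vinf': "vinf d (\<tau>(i := m)) = m"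
      using m_le by (intro ext vinf_eqI[OF i]) auto
    have "?A \<in> sets (pre_sigma (vinf d \<tau>))"
      unfolding m_def[symmetric]
      by (rule equality_set_pre_sigma) (auto intro!: Theta_stopping_time m PiE_mem[OF \<tau> i])
    then have "AE \<omega> in M. \<omega> \<in> ?A \<longrightarrow> \<rho> m (vsup d \<tau>) (\<psi> \<tau>) \<omega> = \<rho> m (vsup d (\<tau>(i := m))) (\<psi> (\<tau>(i := m))) \<omega>"
      using d_property[OF psi_admissible psi_integrable \<tau> PiE_Theta_from_Theta[OF \<tau>'], of ?A]
      unfolding vinf' m_def[symmetric] by auto
    moreover have "AE \<omega> in M. ereal (reward \<psi> m (\<tau>(i := m)) \<omega>) \<le> u_coord \<psi> i m \<omega>"
      by (rule reward_le_u_coord[OF m i \<tau>']) simp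
    ultimately show ?thesis
      using AE_space
    proof eventually_elim
      case (elim \<omega>)
      then show ?case
        using u_coord_le_phi[OF i, of m \<omega>] by (auto simp: reward_def)
    qed
  qed
  have "AE \<omega> in M. \<forall>i\<in>{1..d}. m \<omega> = \<tau> i \<omega> \<longrightarrow> ereal (reward \<psi> m \<tau> \<omega>) \<le> phi \<psi> m \<omega>"
    by (intro AE_finite_allI on_event) auto
  then show ?thesis
    unfolding m_def[symmetric]
  proof eventually_elim
    case (elim \<omega>)
    have "\<exists>i\<in>{1..d}. m \<omega> = \<tau> i \<omega>"
      using Min_in[of "(\<lambda>i. \<tau> i \<omega>) ` {1..d}"] d_ge_1 unfolding m_def vinf_def by fastforce
    then show ?case using elim by blast
  qed
qed

text \<open>
  By consistency the value at \<open>S\<close> can be computed in two stages, first down to the minimum \<open>m\<close> of the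
  components and then from \<open>m\<close> to \<open>S\<close>. After the first stage it is dominated by \<open>\<phi>(m)\<close>.
\<close>

lemma reward_le_u:
  assumes S: "S \<in> Theta" and \<tau>: "\<tau> \<in> {1..d} \<rightarrow>\<^sub>E Theta_from S"
  shows "AE \<omega> in M. ereal (reward \<psi> S \<tau> \<omega>) \<le> u \<psi> S \<omega>"
proof -
  define m where "m = vinf d \<tau>"
  note \<tau>_Theta = PiE_Theta_from_Theta[OF \<tau>]
  have m: "m \<in> Theta" unfolding m_def by (rule vinf_vector_Theta[OF \<tau>_Theta])
  have "AE \<omega> in M. \<forall>i\<in>{1..d}. S \<omega> \<le> \<tau> i \<omega>"
    using \<tau> by (intro AE_finite_allI) (auto simp: Theta_from_def PiE_iff)
  then have S_le: "AE \<omega> in M. S \<omega> \<le> m \<omega>"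
    unfolding m_def vinf_def by eventually_elim (use d_ge_1 in auto)
  have m_le: "AE \<omega> in M. m \<omega> \<le> vsup d \<tau> \<omega>"
    using vinf_le[of 1 d \<tau>] vsup_ge[of 1 d \<tau>] d_ge_1 unfolding m_def
    by (intro AE_I2) (auto intro: order_trans)
  have "AE \<omega> in M. reward \<psi> m \<tau> \<omega> \<le> phi_real \<psi> m \<omega>"
    using reward_at_vinf_le_phi[OF \<tau>_Theta] phi_real_Lp_at(1)[OF m] unfolding m_def[symmetric]
    by eventually_elim simp
  then have "AE \<omega> in M. \<rho> S m (reward \<psi> m \<tau>) \<omega> \<le> \<rho> S m (phi_real \<psi> m) \<omega>"
    by (intro monotonicity S m reward_Lp_at \<tau>_Theta phi_real_Lp_at)
  moreover have "AE \<omega> in M. \<rho> S m (reward \<psi> m \<tau>) \<omega> = reward \<psi> S \<tau> \<omega>"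
    unfolding reward_def
    by (intro consistency S m vsup_vector_Theta \<tau>_Theta S_le m_le psi_Lp_at)
  moreover have "AE \<omega> in M. ereal (\<rho> S m (phi_real \<psi> m) \<omega>) \<le> u \<psi> S \<omega>"
    using u_is_ess_sup[OF S] m S_le unfolding is_ess_sup_def by (simp add: Theta_from_def)
  ultimately show ?thesis
  proof eventually_elim
    case (elim \<omega>)
    then show ?case by (metis ereal_less_eq(3) order_trans)
  qed
qed

lemma V_le_u: "S \<in> Theta \<Longrightarrow> AE \<omega> in M. V \<psi> S \<omega> \<le> u \<psi> S \<omega>"
  using V_is_ess_sup[of S] u_is_ess_sup[of S] reward_le_u[of S] by (simp add: is_ess_sup_def)

section \<open>Optimality of the pasted vector\<close>

text \<open>
  The vector \<open>\<tau>\<close> is worth \<open>\<phi>(\<sigma>)\<close> at time \<open>\<sigma>\<close>: on \<open>B\<^sub>i\<close> it agrees with \<open>\<eta>\<^sub>i\<close>, which attains \<open>u\<^sup>(\<^sup>i\<^sup>)(\<sigma>)\<close>.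
  Thus its value at \<open>S\<close> attains \<open>u(S)\<close>, an upper bound of \<open>V(S)\<close>. The vector \<open>\<eta>\<^sub>i\<close>
  combines \<open>\<sigma>\<close> in position \<open>i\<close> with the other \<open>d - 1\<close> optimal components.
\<close>

lemma pasted_strategy_optimal:
  assumes S: "S \<in> Theta" and \<sigma>: "\<sigma> \<in> Theta_from S"
    and \<sigma>_optimal: "AE \<omega> in M. u \<psi> S \<omega> = ereal (\<rho> S \<sigma> (phi_real \<psi> \<sigma>) \<omega>)"
    and \<eta>: "\<And>i. i \<in> {1..d} \<Longrightarrow> \<eta> i \<in> {1..d} \<rightarrow>\<^sub>E Theta_from \<sigma>" "\<And>i. i \<in> {1..d} \<Longrightarrow> \<eta> i i = \<sigma>"
    and \<eta>_optimal: "\<And>i. i \<in> {1..d} \<Longrightarrow> AE \<omega> in M. u_coord \<psi> i \<sigma> \<omega> = ereal (reward \<psi> \<sigma> (\<eta> i) \<omega>)"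
    and B: "\<And>i. i \<in> {1..d} \<Longrightarrow> B i \<in> sets (pre_sigma \<sigma>)"
    and cover: "AE \<omega> in M. \<exists>i\<in>{1..d}. \<omega> \<in> B i"
    and B_phi: "\<And>i. i \<in> {1..d} \<Longrightarrow> AE \<omega> in M. \<omega> \<in> B i \<longrightarrow> phi \<psi> \<sigma> \<omega> = u_coord \<psi> i \<sigma> \<omega>"
    and \<tau>: "\<tau> \<in> {1..d} \<rightarrow>\<^sub>E Theta_from \<sigma>"
    and \<tau>_eq: "\<And>i j. i \<in> {1..d} \<Longrightarrow> j \<in> {1..d} \<Longrightarrow> AE \<omega> in M. \<omega> \<in> B i \<longrightarrow> \<tau> j \<omega> = \<eta> i j \<omega>"
  shows "AE \<omega> in M. V \<psi> S \<omega> = ereal (reward \<psi> S \<tau> \<omega>)"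
proof -
  have \<sigma>_Theta: "\<sigma> \<in> Theta" and S_le: "AE \<omega> in M. S \<omega> \<le> \<sigma> \<omega>"
    using \<sigma> by (auto simp: Theta_from_def)
  note \<tau>_Theta = PiE_Theta_from_Theta[OF \<tau>] and \<eta>_Theta = PiE_Theta_from_Theta[OF \<eta>(1)]
  have all_eq: "AE \<omega> in M. \<forall>i\<in>{1..d}. \<forall>j\<in>{1..d}. \<omega> \<in> B i \<longrightarrow> \<tau> j \<omega> = \<eta> i j \<omega>"
    by (intro AE_finite_allI \<tau>_eq) auto
  have \<sigma>_le: "AE \<omega> in M. \<forall>j\<in>{1..d}. \<sigma> \<omega> \<le> \<tau> j \<omega>"
    using \<tau> by (intro AE_finite_allI) (auto simp: Theta_from_def PiE_iff)
  have \<sigma>_le_\<eta>: "AE \<omega> in M. \<forall>j\<in>{1..d}. \<sigma> \<omega> \<le> \<eta> i j \<omega>" if "i \<in> {1..d}" for i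
    using \<eta>(1)[OF that] by (intro AE_finite_allI) (auto simp: Theta_from_def PiE_iff)
  have vinf_\<eta>: "AE \<omega> in M. vinf d (\<eta> i) \<omega> = \<sigma> \<omega>" if i: "i \<in> {1..d}" for i
    using \<sigma>_le_\<eta>[OF i]
  proof eventually_elim
    case (elim \<omega>) then show ?case using \<eta>(2)[OF i] by (intro vinf_eqI[OF i]) auto
  qed
  have vinf_\<tau>: "AE \<omega> in M. vinf d \<tau> \<omega> = \<sigma> \<omega>"
    using cover all_eq \<sigma>_le
  proof eventually_elim
    case (elim \<omega>)
    then obtain i where i: "i \<in> {1..d}" "\<omega> \<in> B i" by blast
    then have "\<tau> i \<omega> = \<sigma> \<omega>" using elim(2) \<eta>(2) by auto
    then show ?case using elim(3) by (intro vinf_eqI[OF i(1)]) auto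
  qed
  \<comment> \<open>The \<open>d\<close>-property speaks of the pointwise minimum, which equals \<open>\<sigma>\<close> only almost surely.\<close>
  have shift: "AE \<omega> in M. reward \<psi> (vinf d \<kappa>) \<kappa> \<omega> = reward \<psi> \<sigma> \<kappa> \<omega>"
    if \<kappa>: "\<kappa> \<in> {1..d} \<rightarrow>\<^sub>E Theta" and eq: "AE \<omega> in M. vinf d \<kappa> \<omega> = \<sigma> \<omega>" for \<kappa>
    using eq rho_admissible[OF vinf_vector_Theta[OF \<kappa>] \<sigma>_Theta vsup_vector_Theta[OF \<kappa>] psi_Lp_at[OF \<kappa>]]
    unfolding reward_def by eventually_elim simp
  have on_B: "AE \<omega> in M. \<omega> \<in> B i \<longrightarrow> phi_real \<psi> \<sigma> \<omega> = reward \<psi> \<sigma> \<tau> \<omega>" if i: "i \<in> {1..d}" for i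
  proof -
    have "AE \<omega> in M. \<sigma> \<omega> \<le> vinf d \<tau> \<omega>" using vinf_\<tau> by eventually_elim simp
    then have "B i \<in> sets (pre_sigma (vinf d \<tau>))"
      using vinf_vector_Theta[OF \<tau>_Theta] \<sigma>_Theta
      by (intro pre_sigma_AE_mono[OF _ _ _ _ B[OF i]] Theta_stopping_time Theta_range)
    then have "AE \<omega> in M. \<omega> \<in> B i \<longrightarrow> reward \<psi> (vinf d \<tau>) \<tau> \<omega> = reward \<psi> (vinf d (\<eta> i)) (\<eta> i) \<omega>"
      unfolding reward_def
      by (rule d_property[OF psi_admissible psi_integrable \<tau>_Theta \<eta>_Theta[OF i]]) (rule \<tau>_eq[OF i])
    then show ?thesis
      using shift[OF \<tau>_Theta vinf_\<tau>] shift[OF \<eta>_Theta[OF i] vinf_\<eta>[OF i]]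
        B_phi[OF i] \<eta>_optimal[OF i] phi_real_Lp_at(1)[OF \<sigma>_Theta]
      by eventually_elim auto
  qed
  have "AE \<omega> in M. \<forall>i\<in>{1..d}. \<omega> \<in> B i \<longrightarrow> phi_real \<psi> \<sigma> \<omega> = reward \<psi> \<sigma> \<tau> \<omega>"
    by (intro AE_finite_allI on_B) auto
  with cover have "AE \<omega> in M. phi_real \<psi> \<sigma> \<omega> = reward \<psi> \<sigma> \<tau> \<omega>"
    by eventually_elim blast
  then have "AE \<omega> in M. \<rho> S \<sigma> (phi_real \<psi> \<sigma>) \<omega> = \<rho> S \<sigma> (reward \<psi> \<sigma> \<tau>) \<omega>"
    by (intro rho_AE_cong S \<sigma>_Theta phi_real_Lp_at reward_Lp_at \<tau>_Theta)
  moreover have "AE \<omega> in M. \<rho> S \<sigma> (reward \<psi> \<sigma> \<tau>) \<omega> = reward \<psi> S \<tau> \<omega>"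
    unfolding reward_def
  proof (intro consistency S \<sigma>_Theta vsup_vector_Theta \<tau>_Theta S_le psi_Lp_at)
    show "AE \<omega> in M. \<sigma> \<omega> \<le> vsup d \<tau> \<omega>"
      using \<sigma>_le
    proof eventually_elim
      case (elim \<omega>)
      then show ?case using vsup_ge[of 1 d \<tau> \<omega>] d_ge_1 by force
    qed
  qed
  moreover have "AE \<omega> in M. ereal (reward \<psi> S \<tau> \<omega>) \<le> V \<psi> S \<omega>"
    using V_is_ess_sup[OF S] \<tau> Theta_from_trans[OF _ \<sigma>] unfolding is_ess_sup_def
    by (auto simp: PiE_iff)
  ultimately show ?thesis
    using V_le_u[OF S] \<sigma>_optimal
  proof eventually_elim
    case (elim \<omega>)
    then show ?case by (intro antisym) auto
  qed
qed

end

theorem proposition6: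
  fixes M :: "'a measure" and F :: "real \<Rightarrow> 'a measure" and T :: real
    and \<theta> :: "nat \<Rightarrow> 'a \<Rightarrow> real" and p :: ennreal and d :: nat
    and \<rho> :: "('a \<Rightarrow> real) \<Rightarrow> ('a \<Rightarrow> real) \<Rightarrow> ('a \<Rightarrow> real) \<Rightarrow> 'a \<Rightarrow> real"
    and \<psi> :: "(nat \<Rightarrow> 'a \<Rightarrow> real) \<Rightarrow> 'a \<Rightarrow> real"
    and S \<theta>s :: "'a \<Rightarrow> real"
    and \<theta>m :: "nat \<Rightarrow> nat \<Rightarrow> 'a \<Rightarrow> real"
    and B :: "nat \<Rightarrow> 'a set"
    and \<tau>s :: "nat \<Rightarrow> 'a \<Rightarrow> real"
  assumes setting: "nonlinear_stopping M F T \<theta> p d \<rho>"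
    and psi_admissible: "bermudan_setting.d_admissible M F T \<theta> d \<psi>"
    and psi_integrable: "bermudan_setting.d_p_integrable M F T \<theta> p d \<psi>"
    and V_Lp: "\<And>R. R \<in> bermudan_setting.Theta M F T \<theta> \<Longrightarrow>
           ereal_in_Lp M p (nonlinear_stopping.V M F T \<theta> d \<rho> \<psi> R)"
    and S: "S \<in> bermudan_setting.Theta M F T \<theta>"
    and theta_star: "\<theta>s \<in> bermudan_setting.Theta_from M F T \<theta> S"
    and theta_star_optimal:
      "AE \<omega> in M. nonlinear_stopping.u M F T \<theta> d \<rho> \<psi> S \<omega>
         = ereal (\<rho> S \<theta>s (nonlinear_stopping.phi_real M F T \<theta> d \<rho> \<psi> \<theta>s) \<omega>)"
    and theta_minus: "\<And>i. i \<in> {1..d} \<Longrightarrow>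
           \<theta>m i \<in> ({1..d} - {i}) \<rightarrow>\<^sub>E bermudan_setting.Theta_from M F T \<theta> \<theta>s"
    and theta_minus_optimal: "\<And>i. i \<in> {1..d} \<Longrightarrow>
           AE \<omega> in M. nonlinear_stopping.u_coord M F T \<theta> d \<rho> \<psi> i \<theta>s \<omega>
             = ereal (\<rho> \<theta>s (vsup d ((\<theta>m i)(i := \<theta>s))) (\<psi> ((\<theta>m i)(i := \<theta>s))) \<omega>)"
    and B_meas: "\<And>i. i \<in> {1..d} \<Longrightarrow> B i \<in> sets (filtration.pre_sigma (space M) F \<theta>s)"
    and B_partition: "AE \<omega> in M. \<exists>!i. i \<in> {1..d} \<and> \<omega> \<in> B i"
    and B_phi: "\<And>i. i \<in> {1..d} \<Longrightarrow>
           AE \<omega> in M. \<omega> \<in> B i \<longrightarrow>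
             nonlinear_stopping.phi M F T \<theta> d \<rho> \<psi> \<theta>s \<omega>
               = nonlinear_stopping.u_coord M F T \<theta> d \<rho> \<psi> i \<theta>s \<omega>"
    and tau_star_range: "\<tau>s \<in> {1..d} \<rightarrow>\<^sub>E (space M \<rightarrow> {0..T})"
    and tau_star_def: "\<And>j. j \<in> {1..d} \<Longrightarrow>
           AE \<omega> in M. \<tau>s j \<omega> = \<theta>s \<omega> * indicator (B j) \<omega>
             + (\<Sum>i\<in>{1..d} - {j}. \<theta>m i j \<omega> * indicator (B i) \<omega>)"
  shows "\<tau>s \<in> {1..d} \<rightarrow>\<^sub>E bermudan_setting.Theta_from M F T \<theta> S \<and>
    (AE \<omega> in M. nonlinear_stopping.V M F T \<theta> d \<rho> \<psi> S \<omega>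
       = ereal (\<rho> S (vsup d \<tau>s) (\<psi> \<tau>s) \<omega>))"
proof -
  interpret nonlinear_stopping M F T \<theta> p d \<rho> by (rule setting)
  interpret multiple_stopping_problem M F T \<theta> p d \<rho> \<psi>
    by unfold_locales (fact psi_admissible psi_integrable V_Lp)+
  define \<eta> where "\<eta> i = (\<theta>m i)(i := \<theta>s)" for i
  have \<theta>s: "\<theta>s \<in> Theta" by (rule Theta_from_Theta[OF theta_star])
  have \<eta>: "\<eta> i \<in> {1..d} \<rightarrow>\<^sub>E Theta_from \<theta>s" if "i \<in> {1..d}" for i
    unfolding \<eta>_def using fun_upd_PiE_Theta_from[OF \<theta>s that theta_minus[OF that]] .
  have cover: "AE \<omega> in M. \<exists>i\<in>{1..d}. \<omega> \<in> B i"
    using B_partition by eventually_elim blast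
  have \<tau>s_eq: "AE \<omega> in M. \<omega> \<in> B i \<longrightarrow> \<tau>s j \<omega> = \<eta> i j \<omega>" if i: "i \<in> {1..d}" and j: "j \<in> {1..d}" for i j
    using B_partition tau_star_def[OF j]
  proof eventually_elim
    case (elim \<omega>)
    show ?case
    proof
      assume \<omega>: "\<omega> \<in> B i"
      \<comment> \<open>Exactly one of the sets \<open>B k\<close> contains \<open>\<omega>\<close>, so one term of the defining sum survives.\<close>
      have only: "indicator (B k) \<omega> = (if k = i then 1 else 0 :: real)" if "k \<in> {1..d}" for k
        using elim(1) i \<omega> that by (auto simp: indicator_def)
      have "(\<Sum>k\<in>{1..d} - {j}. \<theta>m k j \<omega> * indicator (B k) \<omega>)
          = (\<Sum>k\<in>{1..d} - {j}. if k = i then \<theta>m i j \<omega> else 0)"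
        by (intro sum.cong refl) (simp add: only)
      also have "\<dots> = (if i = j then 0 else \<theta>m i j \<omega>)"
        using i by (simp add: sum.delta)
      finally show "\<tau>s j \<omega> = \<eta> i j \<omega>"
        using elim(2) only[OF j] by (auto simp: \<eta>_def)
    qed
  qed
  have "\<tau>s j \<in> Theta_from \<theta>s" if j: "j \<in> {1..d}" for j
    by (rule pasting_Theta[OF \<theta>s _ B_meas cover PiE_mem[OF \<eta> j] PiE_mem[OF tau_star_range j] \<tau>s_eq[OF _ j]]) auto
  then have \<tau>s: "\<tau>s \<in> {1..d} \<rightarrow>\<^sub>E Theta_from \<theta>s"
    using tau_star_range by (auto simp: PiE_iff)
  have "AE \<omega> in M. V \<psi> S \<omega> = ereal (reward \<psi> S \<tau>s \<omega>)"
  proof (rule pasted_strategy_optimal[OF S theta_star theta_star_optimal \<eta> _ _ B_meas cover B_phi \<tau>s \<tau>s_eq])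
    fix i assume "i \<in> {1..d}"
    then show "AE \<omega> in M. u_coord \<psi> i \<theta>s \<omega> = ereal (reward \<psi> \<theta>s (\<eta> i) \<omega>)"
      using theta_minus_optimal unfolding reward_def \<eta>_def by blast
  qed (auto simp: \<eta>_def)
  moreover have "\<tau>s \<in> {1..d} \<rightarrow>\<^sub>E Theta_from S"
    using \<tau>s Theta_from_trans[OF _ theta_star] by (auto simp: PiE_iff)
  ultimately show ?thesis by (simp add: reward_def)
qed

end
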